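(* Let $(X,d)$ be a compact metric space, let $\mathcal{H}$ be a Hilbert space, and let $P(X)$ be the collection of all projection-valued measures from the Borel subsets $\mathcal{B}(X)$ of $X$ into the projections on $\mathcal{H}$, equipped with the metric $$\rho(E,F)=\sup_{\phi\in \mathrm{Lip}_1(X)}\left\|\int\phi\,dE-\int\phi\,dF\right\|,$$ where $\|\cdot\|$ is the operator norm on $\mathcal{B}(\mathcal{H})$. Then the metric space $(P(X),\rho)$ is complete.
   Context: $\mathcal{B}(\mathcal{H})$ denotes the bounded operators on the (complex) Hilbert space $\mathcal{H}$. A projection-valued measure $F:\mathcal{B}(X)\to\mathcal{B}(\mathcal{H})$ assigns to each Borel set an orthogonal projection, with $F(\emptyset)=0$, $F(X)=\mathrm{id}_{\mathcal{H}}$, $F(\Delta_1\cap\Delta_2)=F(\Delta_1)F(\Delta_2)$, and countable additivity (in the strong operator topology) on disjoint sequences of Borel sets. For $g,h\in\mathcal{H}$, $F_{g,h}(\Delta)=\langle F(\Delta)g,h\rangle$ is a countably additive complex measure. For a bounded Borel function $\psi:X\to\mathbb{C}$, $\int\psi\,dF$ is the unique bounded operator with $\langle(\int\psi\,dF)g,h\rangle=\int_X\psi\,dF_{g,h}$ for all $g,h\in\mathcal{H}$. $\mathrm{Lip}_1(X)=\{\phi:X\to\mathbb{R}: |\phi(x)-\phi(y)|\le d(x,y)\text{ for all }x,y\in X\}$. *)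

theory Defs
  imports "HOL-Analysis.Analysis"
begin

section \<open>Complex Hilbert spaces\<close>

text \<open>
  The inner product is linear in the first argument: this is the convention under which
  the identity characterising the spectral integral below can hold for complex-valued
  integrands.  Positive definiteness of the inner product is implied by the last axiom together
  with the norm axioms.  The zero space is allowed.
\<close>

class complex_hilbert_space = banach +
  fixes scaleC :: "complex \<Rightarrow> 'a \<Rightarrow> 'a"  (infixr "*\<^sub>C" 75)
    and cinner :: "'a \<Rightarrow> 'a \<Rightarrow> complex"
  assumes scaleC_add_right: "c *\<^sub>C (x + y) = c *\<^sub>C x + c *\<^sub>C y"
    and scaleC_add_left: "(c + d) *\<^sub>C x = c *\<^sub>C x + d *\<^sub>C x"
    and scaleC_scaleC: "c *\<^sub>C (d *\<^sub>C x) = (c * d) *\<^sub>C x"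
    and scaleR_scaleC: "r *\<^sub>R x = complex_of_real r *\<^sub>C x"
    and cinner_commute: "cinner x y = cnj (cinner y x)"
    and cinner_add_left: "cinner (x + y) z = cinner x z + cinner y z"
    and cinner_scaleC_left: "cinner (c *\<^sub>C x) y = c * cinner x y"
    and norm_eq_sqrt_cinner: "norm x = sqrt (Re (cinner x x))"

instantiation complex :: complex_hilbert_space
begin

definition scaleC_complex :: "complex \<Rightarrow> complex \<Rightarrow> complex"
  where "scaleC_complex c x = c * x"

definition cinner_complex :: "complex \<Rightarrow> complex \<Rightarrow> complex"
  where "cinner_complex x y = x * cnj y"

instance
  by standard
    (auto simp: scaleC_complex_def cinner_complex_def algebra_simps scaleR_conv_of_real
      cmod_def power2_eq_square)

end

text \<open>
  The type \<open>'h \<Rightarrow>\<^sub>L 'h\<close> consists of the bounded \<^emph>\<open>real\<close>-linear maps, so complex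
  homogeneity has to be imposed.  Its norm is the operator norm.
\<close>

definition bounded_operators :: "('h::complex_hilbert_space \<Rightarrow>\<^sub>L 'h) set"
  where "bounded_operators =
    {T. \<forall>c x. blinfun_apply T (c *\<^sub>C x) = c *\<^sub>C blinfun_apply T x}"

definition orthogonal_projections :: "('h::complex_hilbert_space \<Rightarrow>\<^sub>L 'h) set"
  where "orthogonal_projections =
    {P \<in> bounded_operators. P o\<^sub>L P = P \<and>
      (\<forall>g h. cinner (blinfun_apply P g) h = cinner g (blinfun_apply P h))}"


section \<open>Integration against a complex measure\<close>

text \<open>
  A countably additive complex measure on the measurable space underlying \<open>M\<close> is represented
  by its set function; the measure carried by \<open>M\<close> itself plays no role.  The integral
  is defined through the Jordan decompositions of the real and imaginary parts:
  the positive part of a signed measure \<open>\<nu>\<close> takes the value \<open>sup {\<nu> B | B \<subseteq> A}\<close> on \<open>A\<close>,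
  and the negative part is the positive part of \<open>- \<nu>\<close>.
\<close>

definition positive_part_measure :: "'x measure \<Rightarrow> ('x set \<Rightarrow> real) \<Rightarrow> 'x measure"
  where "positive_part_measure M \<nu> =
    measure_of (space M) (sets M) (\<lambda>A. ennreal (SUP B\<in>{B \<in> sets M. B \<subseteq> A}. \<nu> B))"

definition signed_measure_integral ::
    "'x measure \<Rightarrow> ('x set \<Rightarrow> real) \<Rightarrow> ('x \<Rightarrow> complex) \<Rightarrow> complex"
  where "signed_measure_integral M \<nu> \<psi> =
    (\<integral>x. \<psi> x \<partial>positive_part_measure M \<nu>) -
    (\<integral>x. \<psi> x \<partial>positive_part_measure M (\<lambda>A. - \<nu> A))"

definition complex_measure_integral ::
    "'x measure \<Rightarrow> ('x set \<Rightarrow> complex) \<Rightarrow> ('x \<Rightarrow> complex) \<Rightarrow> complex"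
  where "complex_measure_integral M \<mu> \<psi> =
    signed_measure_integral M (\<lambda>A. Re (\<mu> A)) \<psi> +
    \<i> * signed_measure_integral M (\<lambda>A. Im (\<mu> A)) \<psi>"


section \<open>Projection-valued measures\<close>

text \<open>
  The space is a set \<open>X\<close> with its subspace Borel structure.  A projection-valued
  measure is a function on the Borel subsets of \<open>X\<close> only; its values elsewhere are fixed
  by extensionality (\<open>\<rightarrow>\<^sub>E\<close>), so that equality in \<open>pvms X\<close> is equality on Borel sets.
\<close>

abbreviation borel_on :: "'x::topological_space set \<Rightarrow> 'x measure"
  where "borel_on X \<equiv> restrict_space borel X"

definition pvms ::
    "'x::topological_space set \<Rightarrow> ('x set \<Rightarrow> 'h::complex_hilbert_space \<Rightarrow>\<^sub>L 'h) set"
  where "pvms X =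
    {F \<in> sets (borel_on X) \<rightarrow>\<^sub>E orthogonal_projections.
      F {} = 0 \<and> F X = id_blinfun \<and>
      (\<forall>A\<in>sets (borel_on X). \<forall>B\<in>sets (borel_on X). F (A \<inter> B) = F A o\<^sub>L F B) \<and>
      (\<forall>A :: nat \<Rightarrow> 'x set. range A \<subseteq> sets (borel_on X) \<longrightarrow> disjoint_family A \<longrightarrow>
        (\<forall>g. (\<lambda>n. blinfun_apply (F (A n)) g) sums blinfun_apply (F (\<Union>n. A n)) g))}"

definition pvm_integral ::
    "'x::topological_space set \<Rightarrow> ('x set \<Rightarrow> 'h::complex_hilbert_space \<Rightarrow>\<^sub>L 'h) \<Rightarrow>
      ('x \<Rightarrow> complex) \<Rightarrow> 'h \<Rightarrow>\<^sub>L 'h"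
  where "pvm_integral X F \<psi> =
    (THE T. T \<in> bounded_operators \<and>
      (\<forall>g h. cinner (blinfun_apply T g) h =
        complex_measure_integral (borel_on X) (\<lambda>A. cinner (blinfun_apply (F A) g) h) \<psi>))"

text \<open>
  The value \<open>0\<close> outside \<open>pvms X\<close> is immaterial; it is needed only because
  \<open>Metric_space\<close> demands nonnegativity and symmetry of the distance function on
  the whole type.  Members of \<open>{\<phi>. 1-lipschitz_on X \<phi>}\<close> are arbitrary off \<open>X\<close>, which
  does not affect the integrals.
\<close>

definition pvm_dist ::
    "'x::metric_space set \<Rightarrow> ('x set \<Rightarrow> 'h::complex_hilbert_space \<Rightarrow>\<^sub>L 'h) \<Rightarrow>
      ('x set \<Rightarrow> 'h \<Rightarrow>\<^sub>L 'h) \<Rightarrow> real"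
  where "pvm_dist X E F =
    (if E \<in> pvms X \<and> F \<in> pvms X
     then SUP \<phi>\<in>{\<phi> :: 'x \<Rightarrow> real. 1-lipschitz_on X \<phi>}.
       norm (pvm_integral X E (\<lambda>x. complex_of_real (\<phi> x)) -
             pvm_integral X F (\<lambda>x. complex_of_real (\<phi> x)))
     else 0)"

end

theory Submission
  imports Defs
begin

text \<open>
  Let \<open>E n\<close> be a Cauchy sequence.  For every Lipschitz \<open>f\<close> the operators \<open>\<integral>f dE n\<close> converge in norm to
  some \<open>T f\<close>, and \<open>T\<close> inherits linearity, positivity, unitality and \<open>(T f)\<^sup>2 = T (f\<^sup>2)\<close>.
  For each vector \<open>g\<close> the positive functional \<open>f \<mapsto> \<langle>T f g, g\<rangle>\<close> is integration against a finite Borel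
  measure \<open>\<mu> g\<close> (Riesz representation).  The Borel sets \<open>A\<close> for which some orthogonal projection \<open>P\<close>
  satisfies \<open>\<parallel>P g\<parallel>\<^sup>2 = \<mu> g A\<close> for all \<open>g\<close> form a Dynkin system.  It contains the open sets, since for
  Lipschitz \<open>u k\<close> increasing to the indicator of an open set, \<open>T (u k)\<close> converges strongly to such a
  projection.  So these projections exist for all Borel sets; they form a projection-valued
  measure \<open>F\<close> with \<open>\<integral>f dF = T f\<close>, and the Cauchy property makes the convergence uniform over
  \<open>1\<close>-Lipschitz \<open>f\<close>.  Equality of operators and additivity in \<open>A\<close> are always read off from quadratic
  forms by polarization.
\<close>

section \<open>Lipschitz functions on a compact set\<close>

text \<open>Two obstacles shape the proof. The first lies in the definitions:
  \<open>pvm_integral\<close> is a definite description over Jordan decompositions, so it must be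
  shown to denote something before it can be used. Polarization writes the real part of
  \<open>F_{g,h}\<close> as a difference of two finite positive measures, and the binary digits of
  the integrand supply an operator series with matching quadratic forms. From there on the argument
  speaks only of positive measures. The second is that norm limits of integrals inform only about
  Lipschitz functions, while the projections sought belong to discontinuous indicators. The bridge
  is the identity for squares: a bump and its square have integrals with the same limit, so the
  strong limit \<open>P\<close> has norm of \<open>P g\<close> squared equal to the form of
  \<open>P\<close> at \<open>g\<close>, which is idempotence. Projections of disjoint sets are then
  orthogonal merely by comparing masses, and this one fact yields both countable unions and the
  product rule for intersections.\<close>

definition is_lipschitz_on :: "'a::metric_space set \<Rightarrow> ('a \<Rightarrow> real) \<Rightarrow> bool"
  where "is_lipschitz_on X f \<longleftrightarrow> (\<exists>C. C-lipschitz_on X f)"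

lemma is_lipschitz_onI: "C-lipschitz_on X f \<Longrightarrow> is_lipschitz_on X f"
  by (auto simp: is_lipschitz_on_def)

lemma is_lipschitz_on_const: "is_lipschitz_on X (\<lambda>_. c)"
  unfolding is_lipschitz_on_def using lipschitz_on_constant by blast

lemma is_lipschitz_on_add:
  "is_lipschitz_on X f \<Longrightarrow> is_lipschitz_on X g \<Longrightarrow> is_lipschitz_on X (\<lambda>x. f x + g x)"
  unfolding is_lipschitz_on_def using lipschitz_on_add by blast

lemma is_lipschitz_on_cmult: "is_lipschitz_on X f \<Longrightarrow> is_lipschitz_on X (\<lambda>x. c * f x)"
  unfolding is_lipschitz_on_def using lipschitz_on_cmult_real by blast

lemma is_lipschitz_on_diff:
  "is_lipschitz_on X f \<Longrightarrow> is_lipschitz_on X g \<Longrightarrow> is_lipschitz_on X (\<lambda>x. f x - g x)"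
  unfolding is_lipschitz_on_def using lipschitz_on_diff by blast

lemma is_lipschitz_on_max:
  assumes "is_lipschitz_on X f" "is_lipschitz_on X g"
  shows "is_lipschitz_on X (\<lambda>x. max (f x) (g x))"
proof -
  obtain C D where C: "C-lipschitz_on X f" and D: "D-lipschitz_on X g"
    using assms by (auto simp: is_lipschitz_on_def)
  have "(max C D)-lipschitz_on X (\<lambda>x. max (f x) (g x))"
  proof (rule lipschitz_onI)
    show "0 \<le> max C D" using lipschitz_on_nonneg[OF C] by simp
    fix x y assume xy: "x \<in> X" "y \<in> X"
    have "dist (max (f x) (g x)) (max (f y) (g y)) \<le> max (dist (f x) (f y)) (dist (g x) (g y))"
      by (auto simp: dist_real_def)
    also have "\<dots> \<le> max (C * dist x y) (D * dist x y)"
      using lipschitz_onD[OF C xy] lipschitz_onD[OF D xy] by linarith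
    also have "\<dots> \<le> max C D * dist x y"
      by (simp add: mult_right_mono)
    finally show "dist (max (f x) (g x)) (max (f y) (g y)) \<le> max C D * dist x y" .
  qed
  then show ?thesis by (rule is_lipschitz_onI)
qed

lemma is_lipschitz_on_min:
  assumes "is_lipschitz_on X f" "is_lipschitz_on X g"
  shows "is_lipschitz_on X (\<lambda>x. min (f x) (g x))"
proof -
  have "is_lipschitz_on X (\<lambda>x. (-1) * max ((-1) * f x) ((-1) * g x))"
    by (intro is_lipschitz_on_cmult is_lipschitz_on_max assms)
  moreover have "(\<lambda>x. (-1) * max ((-1) * f x) ((-1) * g x)) = (\<lambda>x. min (f x) (g x))"
    by (auto simp: fun_eq_iff min_def max_def)
  ultimately show ?thesis by simp
qed

lemma is_lipschitz_on_sum: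
  "(\<And>i. i \<in> I \<Longrightarrow> is_lipschitz_on X (f i)) \<Longrightarrow> is_lipschitz_on X (\<lambda>x. \<Sum>i\<in>I. f i x)"
  by (induction I rule: infinite_finite_induct)
    (auto intro: is_lipschitz_on_const is_lipschitz_on_add)

lemma is_lipschitz_on_infdist: "is_lipschitz_on X (\<lambda>x. infdist x A)"
  by (rule is_lipschitz_onI[of 1], rule lipschitz_onI)
    (auto simp: dist_real_def infdist_triangle_abs)

lemma is_lipschitz_on_continuous: "is_lipschitz_on X f \<Longrightarrow> continuous_on X f"
  by (auto simp: is_lipschitz_on_def intro: lipschitz_on_continuous_on)

lemma is_lipschitz_on_bounded:
  assumes "compact X" "is_lipschitz_on X f"
  obtains B where "B > 0" "\<And>x. x \<in> X \<Longrightarrow> \<bar>f x\<bar> \<le> B"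
proof -
  have "bounded (f ` X)"
    using assms by (intro compact_imp_bounded compact_continuous_image is_lipschitz_on_continuous)
  then show ?thesis using that by (auto simp: bounded_pos)
qed

text \<open>Compactness bounds both factors, which is what closes Lipschitz functions under
  products. Squares are needed to express that \<open>T f\<close> composed with itself is
  \<open>T\<close> of the square.\<close>

lemma is_lipschitz_on_mult:
  assumes X: "compact X" and "is_lipschitz_on X f" "is_lipschitz_on X g"
  shows "is_lipschitz_on X (\<lambda>x. f x * g x)"
proof -
  obtain C D where C: "C-lipschitz_on X f" and D: "D-lipschitz_on X g"
    using assms by (auto simp: is_lipschitz_on_def)
  obtain A where A: "A > 0" "\<And>x. x \<in> X \<Longrightarrow> \<bar>f x\<bar> \<le> A"
    using is_lipschitz_on_bounded[OF X assms(2)] by blast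
  obtain B where B: "B > 0" "\<And>x. x \<in> X \<Longrightarrow> \<bar>g x\<bar> \<le> B"
    using is_lipschitz_on_bounded[OF X assms(3)] by blast
  have "(A * D + C * B)-lipschitz_on X (\<lambda>x. f x * g x)"
  proof (rule lipschitz_onI)
    show "0 \<le> A * D + C * B"
      using A(1) B(1) lipschitz_on_nonneg[OF C] lipschitz_on_nonneg[OF D] by simp
    fix x y assume xy: "x \<in> X" "y \<in> X"
    have "\<bar>f x * g x - f y * g y\<bar> = \<bar>f x * (g x - g y) + (f x - f y) * g y\<bar>"
      by (simp add: algebra_simps)
    also have "\<dots> \<le> \<bar>f x\<bar> * \<bar>g x - g y\<bar> + \<bar>f x - f y\<bar> * \<bar>g y\<bar>"
      by (metis abs_mult abs_triangle_ineq)
    also have "\<dots> \<le> A * (D * dist x y) + (C * dist x y) * B"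
      using A B xy lipschitz_onD[OF C xy] lipschitz_onD[OF D xy] lipschitz_on_nonneg[OF C]
      by (intro add_mono mult_mono) (auto simp: dist_real_def)
    finally show "dist (f x * g x) (f y * g y) \<le> (A * D + C * B) * dist x y"
      by (simp add: dist_real_def algebra_simps)
  qed
  then show ?thesis by (rule is_lipschitz_onI)
qed

lemma borel_measurable_is_lipschitz_on:
  "is_lipschitz_on X f \<Longrightarrow> f \<in> borel_measurable (borel_on X)"
  by (intro borel_measurable_continuous_on_restrict is_lipschitz_on_continuous)

section \<open>Lipschitz approximations of indicators of relatively open sets\<close>

text \<open>The case distinction is needed because \<open>infdist x {} = 0\<close>.\<close>

definition bump :: "'a::metric_space set \<Rightarrow> 'a set \<Rightarrow> nat \<Rightarrow> 'a \<Rightarrow> real"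
  where "bump X U k x = (if X \<subseteq> U then 1 else min 1 (real k * infdist x (X - U)))"

lemma is_lipschitz_on_bump: "is_lipschitz_on Y (bump X U k)"
  unfolding bump_def
  by (cases "X \<subseteq> U")
    (auto intro!: is_lipschitz_on_const is_lipschitz_on_min is_lipschitz_on_cmult is_lipschitz_on_infdist)

lemma bump_nonneg: "0 \<le> bump X U k x"
  by (auto simp: bump_def infdist_nonneg)

lemma bump_le_1: "bump X U k x \<le> 1"
  by (auto simp: bump_def)

lemma bump_eq_0: "x \<in> X - U \<Longrightarrow> bump X U k x = 0"
  by (auto simp: bump_def)

lemma infdist_Diff_openin_pos:
  assumes "openin (top_of_set X) U" "x \<in> U" "\<not> X \<subseteq> U"
  shows "infdist x (X - U) > 0"
proof -
  obtain T where T: "open T" "U = X \<inter> T" using assms(1) by (auto simp: openin_open)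
  have "x \<notin> closure (X - U)"
  proof
    assume "x \<in> closure (X - U)"
    moreover have "x \<in> T" using assms T by auto
    ultimately obtain y where "y \<in> X - U" "y \<in> T"
      using T(1) by (metis closure_iff_nhds_not_empty disjoint_iff subset_refl)
    then show False using T by auto
  qed
  then show ?thesis
    using assms(3) by (metis Diff_eq_empty_iff in_closure_iff_infdist_zero infdist_nonneg
        less_eq_real_def)
qed

lemma eventually_bump_eq_1:
  assumes "openin (top_of_set X) U" "x \<in> U"
  shows "\<forall>\<^sub>F k in sequentially. bump X U k x = 1"
proof (cases "X \<subseteq> U")
  case False
  then have d: "infdist x (X - U) > 0" using infdist_Diff_openin_pos assms by blast
  obtain k0 where k0: "1 < real k0 * infdist x (X - U)"
    using ex_less_of_nat_mult[OF d] by auto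
  have "bump X U k x = 1" if "k \<ge> k0" for k
  proof -
    have "real k0 * infdist x (X - U) \<le> real k * infdist x (X - U)"
      using that d by (intro mult_right_mono) auto
    then show ?thesis using k0 by (auto simp: bump_def)
  qed
  then show ?thesis by (auto simp: eventually_sequentially)
qed (simp add: bump_def)

lemma bump_tendsto_indicator:
  assumes "openin (top_of_set X) U" "x \<in> X"
  shows "(\<lambda>k. bump X U k x) \<longlonglongrightarrow> indicator U x"
proof (cases "x \<in> U")
  case True
  then show ?thesis
    using eventually_bump_eq_1[OF assms(1)] by (simp add: tendsto_eventually)
next
  case False
  then show ?thesis using assms by (simp add: bump_eq_0)
qed

text \<open>Closedness makes \<open>X\<close> itself Borel, as \<open>sigma_sets_Int\<close>
  requires. The relatively open sets form an intersection-stable generator, the starting point of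
  every Dynkin argument below.\<close>

lemma sets_borel_on:
  assumes "closed X"
  shows "sets (borel_on X) = sigma_sets X {U. openin (top_of_set X) U}"
proof -
  have "sets (borel_on X) = (\<inter>) X ` sigma_sets UNIV {S. open S}"
    by (simp add: sets_restrict_space sets_borel)
  also have "\<dots> = sigma_sets X ((\<inter>) X ` {S. open S})"
    using borel_closed[OF assms] by (intro sigma_sets_Int) (auto simp: sets_borel)
  also have "(\<inter>) X ` {S. open S} = {U. openin (top_of_set X) U}"
    by (auto simp: openin_open)
  finally show ?thesis .
qed

lemma openin_in_sets_borel_on: "openin (top_of_set X) U \<Longrightarrow> U \<in> sets (borel_on X)"
  by (auto simp: sets_restrict_space openin_open)

lemma Int_stable_openin: "Int_stable {U. openin (top_of_set X) U}"
  by (auto simp: Int_stable_def)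

section \<open>Representation of positive functionals on Lipschitz functions\<close>

text \<open>Positivity looks only at values on \<open>X\<close>; hence, by monotonicity in both
  directions, \<open>L f\<close> depends on \<open>f\<close> only through its restriction to
  \<open>X\<close>.\<close>

locale positive_lipschitz_functional =
  fixes X :: "'a::metric_space set" and L :: "('a \<Rightarrow> real) \<Rightarrow> real"
  assumes compact: "compact X"
    and add: "is_lipschitz_on X f \<Longrightarrow> is_lipschitz_on X g \<Longrightarrow> L (\<lambda>x. f x + g x) = L f + L g"
    and cmult: "is_lipschitz_on X f \<Longrightarrow> L (\<lambda>x. c * f x) = c * L f"
    and nonneg: "is_lipschitz_on X f \<Longrightarrow> (\<And>x. x \<in> X \<Longrightarrow> 0 \<le> f x) \<Longrightarrow> 0 \<le> L f"
begin

lemma mono: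
  assumes "is_lipschitz_on X f" "is_lipschitz_on X g" "\<And>x. x \<in> X \<Longrightarrow> f x \<le> g x"
  shows "L f \<le> L g"
proof -
  have "0 \<le> L (\<lambda>x. g x + (-1) * f x)"
    using assms by (intro nonneg is_lipschitz_on_add is_lipschitz_on_cmult) auto
  also have "\<dots> = L g + (-1) * L f"
    by (subst add) (simp_all only: cmult is_lipschitz_on_cmult assms)
  finally show ?thesis by simp
qed

lemma const: "L (\<lambda>_. c) = c * L (\<lambda>_. 1)"
  using cmult[of "\<lambda>_. 1" c] by (simp add: is_lipschitz_on_const)

lemma sum:
  assumes "\<And>i. i \<in> I \<Longrightarrow> is_lipschitz_on X (f i)"
  shows "L (\<lambda>x. \<Sum>i\<in>I. f i x) = (\<Sum>i\<in>I. L (f i))"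
  using assms
  by (induction I rule: infinite_finite_induct) (simp_all add: const[of 0] add is_lipschitz_on_sum)

section \<open>The content of relatively open sets\<close>

text \<open>In contrast to the usual Riesz construction, \<open>f\<close> has to vanish off
  \<open>U\<close> but its support may reach the boundary of \<open>U\<close>. The missing gap is
  created later by cutting \<open>f\<close> at a small height.\<close>

definition subordinate :: "'a set \<Rightarrow> ('a \<Rightarrow> real) set"
  where "subordinate U =
    {f. is_lipschitz_on X f \<and> (\<forall>x\<in>X. 0 \<le> f x \<and> f x \<le> 1) \<and> (\<forall>x\<in>X-U. f x = 0)}"

definition content :: "'a set \<Rightarrow> real"
  where "content U = (SUP f\<in>subordinate U. L f)"

lemma subordinateI:
  assumes "is_lipschitz_on X f" "\<And>x. x \<in> X \<Longrightarrow> 0 \<le> f x" "\<And>x. x \<in> X \<Longrightarrow> f x \<le> 1"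
    "\<And>x. x \<in> X \<Longrightarrow> x \<notin> U \<Longrightarrow> f x = 0"
  shows "f \<in> subordinate U"
  using assms by (auto simp: subordinate_def)

lemma zero_subordinate: "(\<lambda>_. 0) \<in> subordinate U"
  by (auto simp: subordinate_def is_lipschitz_on_const)

lemma subordinate_le_L1: "f \<in> subordinate U \<Longrightarrow> L f \<le> L (\<lambda>_. 1)"
  by (intro mono is_lipschitz_on_const) (auto simp: subordinate_def)

lemma le_content: "f \<in> subordinate U \<Longrightarrow> L f \<le> content U"
  unfolding content_def by (intro cSUP_upper bdd_aboveI2[of _ _ "L (\<lambda>_. 1)"] subordinate_le_L1)

lemma content_le: "(\<And>f. f \<in> subordinate U \<Longrightarrow> L f \<le> c) \<Longrightarrow> content U \<le> c"
  unfolding content_def using zero_subordinate by (intro cSUP_least) auto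

lemma content_nonneg: "0 \<le> content U"
  using le_content[OF zero_subordinate] const[of 0] by simp

lemma content_mono: "U \<subseteq> V \<Longrightarrow> content U \<le> content V"
  by (intro content_le le_content) (auto simp: subordinate_def)

lemma content_empty: "content {} = 0"
proof (rule antisym[OF content_le content_nonneg])
  fix f assume "f \<in> subordinate {}"
  then have "L f \<le> L (\<lambda>_. 0)" by (intro mono) (auto simp: subordinate_def is_lipschitz_on_const)
  then show "L f \<le> 0" using const[of 0] by simp
qed

lemma content_space: "content X = L (\<lambda>_. 1)"
proof (rule antisym)
  show "content X \<le> L (\<lambda>_. 1)" by (intro content_le subordinate_le_L1)
  show "L (\<lambda>_. 1) \<le> content X"
    by (intro le_content subordinateI is_lipschitz_on_const) auto
qed

lemma bump_subordinate: "bump X U k \<in> subordinate U"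
  by (auto simp: subordinate_def is_lipschitz_on_bump bump_nonneg bump_le_1 bump_eq_0)

text \<open>On the open set \<open>V N\<close> some bump of index at most \<open>N\<close> has
  already reached 1 at steepness \<open>N\<close>. The sets \<open>V N\<close> increase with
  \<open>N\<close> and cover \<open>K\<close>, so compactness picks a single \<open>N\<close> that
  serves as number of sets and as steepness at once.\<close>

lemma bump_sum_ge_1:
  assumes K: "compact K" "K \<subseteq> X" "K \<subseteq> (\<Union>i. U i)" and U: "\<And>i. openin (top_of_set X) (U i)"
  obtains N where "\<And>x. x \<in> K \<Longrightarrow> 1 \<le> (\<Sum>i\<le>N. bump X (U i) N x)"
proof -
  define V where "V = (\<lambda>N::nat. \<Union>i\<in>{..N}. if X \<subseteq> U i then UNIV
    else {x. 1 < real N * infdist x (X - U i)})"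
  have op: "open (V N)" for N
    unfolding V_def by (intro open_UN) (auto intro!: open_Collect_less continuous_intros)
  have "K \<subseteq> (\<Union>N. V N)"
  proof
    fix x assume x: "x \<in> K"
    then obtain i where i: "x \<in> U i" using K by auto
    show "x \<in> (\<Union>N. V N)"
    proof (cases "X \<subseteq> U i")
      case True
      then have "x \<in> V i" by (auto simp: V_def)
      then show ?thesis by blast
    next
      case False
      then have d: "infdist x (X - U i) > 0"
        using infdist_Diff_openin_pos[OF U i] by blast
      obtain k0 where k0: "1 < real k0 * infdist x (X - U i)"
        using ex_less_of_nat_mult[OF d] by auto
      also have "\<dots> \<le> real (max k0 i) * infdist x (X - U i)"
        using d by (intro mult_right_mono) auto
      finally have "x \<in> V (max k0 i)" using False by (auto simp: V_def intro!: bexI[of _ i])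
      then show ?thesis by blast
    qed
  qed
  then obtain C where C: "finite C" "K \<subseteq> (\<Union>N\<in>C. V N)"
    by (rule compactE_image[OF K(1) op])
  \<comment> \<open>The inserted 0 covers an empty \<open>C\<close>, which occurs when
    \<open>K\<close> is empty.\<close>
  define N where "N = Max (insert 0 C)"
  have "1 \<le> (\<Sum>i\<le>N. bump X (U i) N x)" if x: "x \<in> K" for x
  proof -
    obtain M where M: "M \<in> C" "x \<in> V M" using C x by auto
    have MN: "M \<le> N" using C M by (auto simp: N_def)
    from M obtain i where i: "i \<le> M" and "X \<subseteq> U i \<or> 1 < real M * infdist x (X - U i)"
      by (auto simp: V_def split: if_splits)
    moreover have "real M * infdist x (X - U i) \<le> real N * infdist x (X - U i)"
      using MN by (intro mult_right_mono infdist_nonneg) auto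
    ultimately have "bump X (U i) N x = 1" by (auto simp: bump_def)
    moreover have "bump X (U i) N x \<le> (\<Sum>i\<le>N. bump X (U i) N x)"
      using i MN by (intro member_le_sum) (auto simp: bump_nonneg)
    ultimately show ?thesis by simp
  qed
  then show ?thesis using that by blast
qed

text \<open>A function subordinate to the union exceeds \<open>e\<close> only on a compact subset of the union,
  where it is dominated by finitely many bumps.\<close>

lemma content_UN_le:
  assumes U: "\<And>i::nat. openin (top_of_set X) (U i)"
  shows "ennreal (content (\<Union>i. U i)) \<le> (\<Sum>i. ennreal (content (U i)))"
proof -
  have *: "ennreal (L f) \<le> (\<Sum>i. ennreal (content (U i)))"
    if f: "f \<in> subordinate (\<Union>i. U i)" for f
  proof (rule ennreal_le_epsilon)
    fix e :: real assume e: "0 < e"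
    \<comment> \<open>Chosen so that the constant function \<open>e'\<close> costs at most
      \<open>e\<close> under \<open>L\<close>; the added 1 guards against
      \<open>L (\<lambda>_. 1) = 0\<close>.\<close>
    define e' where "e' = e / (L (\<lambda>_. 1) + 1)"
    have L1: "L (\<lambda>_. 1) \<ge> 0" by (intro nonneg is_lipschitz_on_const) auto
    have e': "e' > 0" "e' * L (\<lambda>_. 1) \<le> e"
      using e L1 by (auto simp: e'_def field_simps)
    have lip: "is_lipschitz_on X f" using f by (simp add: subordinate_def)
    define K where "K = {x\<in>X. e' \<le> f x}"
    have "closedin (top_of_set X) (X \<inter> f -` {e'..})"
      using is_lipschitz_on_continuous[OF lip] by (intro continuous_closedin_preimage) auto
    then have "compact K"
      using closedin_compact[OF compact] by (simp add: K_def Int_def vimage_def)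
    moreover have "K \<subseteq> (\<Union>i. U i)"
    proof
      fix x assume "x \<in> K"
      then have "x \<in> X" "f x \<noteq> 0" using e' by (auto simp: K_def)
      then show "x \<in> (\<Union>i. U i)" using f unfolding subordinate_def by blast
    qed
    ultimately obtain N where N: "\<And>x. x \<in> K \<Longrightarrow> 1 \<le> (\<Sum>i\<le>N. bump X (U i) N x)"
      using bump_sum_ge_1[of K U] U by (auto simp: K_def)
    have "L f \<le> L (\<lambda>x. e' + (\<Sum>i\<le>N. bump X (U i) N x))"
    proof (intro mono lip is_lipschitz_on_add is_lipschitz_on_const is_lipschitz_on_sum
        is_lipschitz_on_bump)
      fix x assume x: "x \<in> X"
      show "f x \<le> e' + (\<Sum>i\<le>N. bump X (U i) N x)"
      proof (cases "x \<in> K")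
        case True
        then show ?thesis using N[OF True] x f e' by (auto simp: subordinate_def)
      next
        case False
        then have "f x \<le> e'" using x by (auto simp: K_def)
        moreover have "0 \<le> (\<Sum>i\<le>N. bump X (U i) N x)" by (intro sum_nonneg bump_nonneg)
        ultimately show ?thesis by simp
      qed
    qed
    also have "\<dots> = e' * L (\<lambda>_. 1) + (\<Sum>i\<le>N. L (bump X (U i) N))"
      by (subst add) (simp_all add: is_lipschitz_on_const is_lipschitz_on_sum is_lipschitz_on_bump
          const[of e'] sum)
    also have "\<dots> \<le> e + (\<Sum>i\<le>N. content (U i))"
      by (intro add_mono sum_mono le_content bump_subordinate e')
    finally have "ennreal (L f) \<le> ennreal (e + (\<Sum>i\<le>N. content (U i)))"
      by (rule ennreal_leI)
    also have "\<dots> = (\<Sum>i\<le>N. ennreal (content (U i))) + ennreal e"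
      using e by (simp add: sum_ennreal content_nonneg ennreal_plus sum_nonneg add.commute)
    also have "\<dots> \<le> (\<Sum>i. ennreal (content (U i))) + ennreal e"
      by (intro add_right_mono sum_le_suminf) auto
    finally show "ennreal (L f) \<le> (\<Sum>i. ennreal (content (U i))) + ennreal e" .
  qed
  show ?thesis
  \<comment> \<open>\<open>content\<close> is a real supremum, so the bound has to be brought back
    from \<open>ennreal\<close> to a real number; an infinite sum leaves nothing to show.\<close>
  proof (cases "(\<Sum>i. ennreal (content (U i)))")
    case (real r)
    then have "content (\<Union>i. U i) \<le> r"
      using * by (intro content_le) (auto simp: ennreal_le_iff)
    then show ?thesis using real by (simp add: ennreal_leI)
  qed auto
qed

section \<open>Outer measure and Caratheodory extension\<close>

definition omeasure :: "'a set \<Rightarrow> ennreal"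
  where "omeasure A = (INF U\<in>{U. openin (top_of_set X) U \<and> A \<subseteq> U}. ennreal (content U))"

lemma omeasure_le: "openin (top_of_set X) U \<Longrightarrow> A \<subseteq> U \<Longrightarrow> omeasure A \<le> ennreal (content U)"
  unfolding omeasure_def by (intro INF_lower) auto

lemma omeasure_openin: "openin (top_of_set X) U \<Longrightarrow> omeasure U = ennreal (content U)"
  unfolding omeasure_def
  by (intro antisym INF_lower INF_greatest ennreal_leI content_mono) auto

lemma outer_measure_space_omeasure: "outer_measure_space (Pow X) omeasure"
  unfolding outer_measure_space_def
proof (intro conjI)
  show "positive (Pow X) omeasure"
    by (simp add: positive_def omeasure_openin content_empty)
  show "increasing (Pow X) omeasure"
    unfolding increasing_def omeasure_def by (auto intro!: INF_superset_mono)
  show "countably_subadditive (Pow X) omeasure"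
    unfolding countably_subadditive_def
  proof safe
    fix A :: "nat \<Rightarrow> 'a set"
    show "omeasure (\<Union>i. A i) \<le> (\<Sum>n. omeasure (A n))"
    proof (rule ennreal_le_epsilon)
      \<comment> \<open>A finite sum has finite terms, and only for a finite term does adding a
        positive slack give a strictly larger value, as needed to pick \<open>U n\<close> near the
        infimum.\<close>
      fix e :: real assume e: "0 < e" and "(\<Sum>n. omeasure (A n)) < top"
      then have *: "omeasure (A n) < omeasure (A n) + e * (1/2)^Suc n" for n
        by (auto simp add: less_top dest!: ennreal_suminf_lessD)
      have "\<exists>U. openin (top_of_set X) U \<and> A n \<subseteq> U \<and>
          ennreal (content U) \<le> omeasure (A n) + e * (1/2)^Suc n" for n
      proof -
        have "\<exists>U\<in>{U. openin (top_of_set X) U \<and> A n \<subseteq> U}.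
            ennreal (content U) < omeasure (A n) + e * (1/2)^Suc n"
          using *[of n] unfolding INF_less_iff[symmetric] by (simp add: omeasure_def)
        then show ?thesis by (auto intro: less_imp_le)
      qed
      then obtain U where U: "\<And>n. openin (top_of_set X) (U n)" "\<And>n. A n \<subseteq> U n"
          "\<And>n. ennreal (content (U n)) \<le> omeasure (A n) + e * (1/2)^Suc n"
        by metis
      have "omeasure (\<Union>i. A i) \<le> ennreal (content (\<Union>i. U i))"
        using U by (intro omeasure_le) (auto intro!: openin_Union)
      also have "\<dots> \<le> (\<Sum>i. ennreal (content (U i)))"
        by (rule content_UN_le[OF U(1)])
      also have "\<dots> \<le> (\<Sum>n. omeasure (A n) + e * (1/2) ^ Suc n)"
        by (intro suminf_le U) auto
      also have "\<dots> = (\<Sum>n. omeasure (A n)) + (\<Sum>n. ennreal e * ennreal ((1/2) ^ Suc n))"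
        using e by (subst suminf_add[symmetric])
          (auto simp del: ennreal_suminf_cmult simp add: ennreal_mult[symmetric])
      also have "\<dots> = (\<Sum>n. omeasure (A n)) + e"
        unfolding ennreal_suminf_cmult
        by (subst suminf_ennreal_eq[OF zero_le_power power_half_series]) auto
      finally show "omeasure (\<Union>i. A i) \<le> (\<Sum>n. omeasure (A n)) + e" .
    qed
  qed
qed

text \<open>Caratheodory's inequality, tested against an open \<open>W\<close> around
  \<open>A\<close>. Take \<open>f\<close> nearly optimal for \<open>W \<inter> U\<close> and shave
  \<open>e'\<close> off it to get \<open>g\<close>. Then \<open>g\<close> vanishes on the open set
  \<open>V\<close> where \<open>f < e'\<close>, and \<open>V\<close> contains \<open>A - U\<close>.
  Any \<open>h\<close> subordinate to \<open>V\<close> may therefore be added to \<open>g\<close>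
  without exceeding 1, and \<open>g + h\<close> competes for \<open>content W\<close>.\<close>

lemma openin_additive_le:
  assumes U: "openin (top_of_set X) U" and W: "openin (top_of_set X) W" and A: "A \<subseteq> W"
  shows "omeasure (A \<inter> U) + omeasure (A - U) \<le> ennreal (content W)"
proof (rule ennreal_le_epsilon)
  fix e :: real assume e: "0 < e"
  \<comment> \<open>Two losses must add up to \<open>e\<close>: one \<open>e'\<close> from missing
    the supremum and \<open>e' * L (\<lambda>_. 1)\<close> from shaving.\<close>
  define e' where "e' = e / (L (\<lambda>_. 1) + 1)"
  have L1: "L (\<lambda>_. 1) \<ge> 0" by (intro nonneg is_lipschitz_on_const) auto
  have e': "e' > 0" "e' * L (\<lambda>_. 1) + e' = e"
  proof -
    show "e' > 0" using e L1 by (simp add: e'_def)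
    have "e' * (L (\<lambda>_. 1) + 1) = e" using L1 by (simp add: e'_def)
    then show "e' * L (\<lambda>_. 1) + e' = e" by (simp add: distrib_left)
  qed
  have "\<exists>f\<in>subordinate (W \<inter> U). content (W \<inter> U) - e' < L f"
    using content_le[of "W \<inter> U" "content (W \<inter> U) - e'"] e' by force
  then obtain f where f: "f \<in> subordinate (W \<inter> U)" "content (W \<inter> U) - e' < L f"
    by blast
  then have lip: "is_lipschitz_on X f" by (simp add: subordinate_def)
  define g where "g = (\<lambda>x. max 0 (f x - e'))"
  have lipg: "is_lipschitz_on X g"
    unfolding g_def by (intro is_lipschitz_on_max is_lipschitz_on_diff is_lipschitz_on_const lip)
  have "L f \<le> L (\<lambda>x. g x + e')"
    by (intro mono lip is_lipschitz_on_add lipg is_lipschitz_on_const) (auto simp: g_def)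
  also have "\<dots> = L g + e' * L (\<lambda>_. 1)"
    by (simp add: add lipg is_lipschitz_on_const const[of e'])
  finally have Lg: "L f \<le> L g + e' * L (\<lambda>_. 1)" .
  define V where "V = W \<inter> (X \<inter> f -` {..<e'})"
  have V: "openin (top_of_set X) V"
    unfolding V_def using is_lipschitz_on_continuous[OF lip]
    by (intro openin_Int W continuous_openin_preimage_gen open_lessThan)
  have AX: "A \<subseteq> X" using A openin_imp_subset[OF W] by auto
  have "content V \<le> content W - L g"
  proof (rule content_le)
    fix h assume h: "h \<in> subordinate V"
    then have liph: "is_lipschitz_on X h" by (simp add: subordinate_def)
    have "(\<lambda>x. g x + h x) \<in> subordinate W"
    proof (intro subordinateI is_lipschitz_on_add lipg liph)
      fix x assume x: "x \<in> X"
      show "0 \<le> g x + h x" using h x by (auto simp: g_def subordinate_def)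
      show "g x + h x \<le> 1"
      proof (cases "x \<in> V")
        case True
        then show ?thesis using h x by (auto simp: g_def subordinate_def V_def)
      next
        case False
        then have "h x = 0" using h x by (auto simp: subordinate_def)
        then show ?thesis using f x e' by (auto simp: g_def subordinate_def max_def add_increasing2)
      qed
      show "g x + h x = 0" if "x \<notin> W"
        using that h f x e' by (auto simp: g_def subordinate_def V_def)
    qed
    from le_content[OF this] show "L h \<le> content W - L g" by (simp add: add lipg liph)
  qed
  then have "content (W \<inter> U) + content V \<le> content W + e"
    using f(2) Lg e' by linarith
  then have "ennreal (content (W \<inter> U)) + ennreal (content V) \<le> ennreal (content W) + ennreal e"
    using e by (simp add: ennreal_plus[symmetric] content_nonneg ennreal_leI del: ennreal_plus)
  moreover have "omeasure (A \<inter> U) \<le> ennreal (content (W \<inter> U))"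
    using A by (intro omeasure_le openin_Int W U) auto
  moreover have "omeasure (A - U) \<le> ennreal (content V)"
  proof (intro omeasure_le V subsetI)
    fix x assume x: "x \<in> A - U"
    then have "f x = 0" using f(1) AX by (auto simp: subordinate_def)
    then show "x \<in> V" using x A AX e' by (auto simp: V_def)
  qed
  ultimately show "omeasure (A \<inter> U) + omeasure (A - U) \<le> ennreal (content W) + ennreal e"
    using add_mono order_trans by blast
qed

lemma openin_lambda_system:
  assumes U: "openin (top_of_set X) U"
  shows "U \<in> lambda_system X (Pow X) omeasure"
proof -
  interpret P: sigma_algebra X "Pow X" by (rule sigma_algebra_Pow)
  have pos: "positive (Pow X) omeasure" and inc: "increasing (Pow X) omeasure"
    and sub: "countably_subadditive (Pow X) omeasure"
    using outer_measure_space_omeasure by (auto simp: outer_measure_space_def)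
  show ?thesis
    unfolding P.lambda_system_eq
  proof (intro CollectI conjI ballI antisym)
    show "U \<in> Pow X" using openin_imp_subset[OF U] by auto
    fix A assume A: "A \<in> Pow X"
    show "omeasure (A \<inter> U) + omeasure (A - U) \<le> omeasure A"
      unfolding omeasure_def[of A] using openin_additive_le[OF U] by (intro INF_greatest) auto
    have "subadditive (Pow X) omeasure"
      using pos sub by (rule P.countably_subadditive_subadditive)
    from subadditiveD[OF this, of "A \<inter> U" "A - U"]
    show "omeasure A \<le> omeasure (A \<inter> U) + omeasure (A - U)"
      using A by (auto simp: Int_Diff_Un Int_Diff)
  qed
qed

definition rep_measure :: "'a measure"
  where "rep_measure = measure_of X (sets (borel_on X)) omeasure"

lemma space_borel_on: "space (borel_on X) = X"
  by (simp add: space_restrict_space)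

lemma sets_rep_measure: "sets rep_measure = sets (borel_on X)"
  unfolding rep_measure_def
  using sets.sigma_sets_eq[of "borel_on X"] sets.space_closed[of "borel_on X"]
  by (simp add: space_borel_on)

lemma space_rep_measure: "space rep_measure = X"
  using sets_eq_imp_space_eq[OF sets_rep_measure] by (simp add: space_borel_on)

lemma emeasure_rep_measure:
  assumes "A \<in> sets (borel_on X)"
  shows "emeasure rep_measure A = omeasure A"
proof -
  interpret P: sigma_algebra X "Pow X" by (rule sigma_algebra_Pow)
  let ?\<Lambda> = "lambda_system X (Pow X) omeasure"
  have ms: "measure_space X ?\<Lambda> omeasure"
    by (rule P.caratheodory_lemma[OF outer_measure_space_omeasure])
  then interpret S: sigma_algebra X ?\<Lambda> by (simp add: measure_space_def)
  have "sets (borel_on X) \<subseteq> ?\<Lambda>"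
    unfolding sets_borel_on[OF compact_imp_closed[OF compact]]
    using openin_lambda_system by (intro S.sigma_sets_subset) auto
  moreover have "sigma_algebra X (sets (borel_on X))"
    using sets.sigma_algebra_axioms[of "borel_on X"] by (simp add: space_borel_on)
  ultimately have "measure_space X (sets (borel_on X)) omeasure"
    using measure_down[OF ms] by blast
  then show ?thesis
    unfolding rep_measure_def using assms by (intro emeasure_measure_of_sigma)
      (auto simp: measure_space_def)
qed

lemma emeasure_rep_measure_openin:
  "openin (top_of_set X) U \<Longrightarrow> emeasure rep_measure U = ennreal (content U)"
  by (simp add: emeasure_rep_measure openin_in_sets_borel_on omeasure_openin)

lemma measure_rep_measure_openin:
  "openin (top_of_set X) U \<Longrightarrow> measure rep_measure U = content U"
  by (simp add: measure_def emeasure_rep_measure_openin content_nonneg)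

lemma finite_measure_rep_measure: "finite_measure rep_measure"
  by (rule finite_measureI) (simp add: space_rep_measure emeasure_rep_measure_openin)

end

section \<open>The functional is integration against the constructed measure\<close>

text \<open>Telescoping: the \<open>i\<close>-th summand is the increment of
  \<open>min t (i * d)\<close> when \<open>i\<close> grows by one.\<close>

lemma sum_truncations:
  fixes t d :: real
  assumes "0 \<le> t" "0 \<le> d"
  shows "(\<Sum>i<n. min (max (t - real i * d) 0) d) = min t (real n * d)"
  using assms by (induction n) (auto simp: min_def max_def algebra_simps)

text \<open>For positive \<open>d\<close>, at most \<open>t / d + 1\<close> of the levels
  \<open>i * d\<close> lie strictly below \<open>t\<close>, level 0 included; this accounts for the
  extra \<open>d\<close>.\<close>

lemma sum_levels_le:
  fixes t d :: real
  assumes "0 \<le> t" "0 \<le> d"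
  shows "(\<Sum>i<n. if real i * d < t then d else 0) \<le> min (t + d) (real n * d)"
  using assms by (induction n) (auto simp: min_def algebra_simps split: if_splits)

context positive_lipschitz_functional begin

lemma integrable_rep_measure:
  assumes "is_lipschitz_on X f"
  shows "integrable rep_measure f"
proof -
  interpret finite_measure rep_measure by (rule finite_measure_rep_measure)
  obtain B where B: "\<And>x. x \<in> X \<Longrightarrow> \<bar>f x\<bar> \<le> B"
    using is_lipschitz_on_bounded[OF compact assms] by blast
  have "f \<in> borel_measurable rep_measure"
    using borel_measurable_is_lipschitz_on[OF assms]
    by (simp cong: measurable_cong_sets add: sets_rep_measure)
  then show ?thesis
    using B by (intro integrable_const_bound[of _ B]) (auto simp: space_rep_measure)
qed

text \<open>Layer cake: \<open>f\<close> is cut into slices of height \<open>1 / N\<close>, the \<open>i\<close>-th of which is subordinate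
  to \<open>{f > i / N}\<close>.\<close>

lemma le_integral_rep_measure_aux:
  assumes lip: "is_lipschitz_on X f" and f: "\<And>x. x \<in> X \<Longrightarrow> 0 \<le> f x" "\<And>x. x \<in> X \<Longrightarrow> f x \<le> 1"
    and N: "N > 0"
  shows "L f \<le> (\<integral>x. f x \<partial>rep_measure) + L (\<lambda>_. 1) / real N"
proof -
  interpret finite_measure rep_measure by (rule finite_measure_rep_measure)
  define d where "d = 1 / real N"
  have d: "d > 0" "real N * d = 1" using N by (auto simp: d_def)
  define U where "U i = X \<inter> f -` {real i * d<..}" for i
  have U: "openin (top_of_set X) (U i)" for i
    unfolding U_def using is_lipschitz_on_continuous[OF lip]
    by (intro continuous_openin_preimage_gen open_greaterThan)
  have intU: "integrable rep_measure (\<lambda>x. d * indicator (U i) x :: real)" for i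
    by (intro integrable_mult_right integrable_real_indicator)
      (simp_all add: sets_rep_measure openin_in_sets_borel_on[OF U] emeasure_finite less_top[symmetric])
  define s where "s i x = min (max (f x - real i * d) 0) d" for i x
  have lips: "is_lipschitz_on X (s i)" for i
    unfolding s_def
    by (intro is_lipschitz_on_min is_lipschitz_on_max is_lipschitz_on_diff is_lipschitz_on_const lip)
  have "L f \<le> L (\<lambda>x. \<Sum>i<N. s i x)"
    by (intro mono lip is_lipschitz_on_sum lips)
      (use f d in \<open>simp add: s_def sum_truncations\<close>)
  also have "\<dots> = (\<Sum>i<N. L (s i))" by (simp add: sum lips)
  also have "\<dots> \<le> (\<Sum>i<N. d * measure rep_measure (U i))"
  proof (rule sum_mono)
    fix i
    have "(\<lambda>x. real N * s i x) \<in> subordinate (U i)"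
    proof (intro subordinateI is_lipschitz_on_cmult lips)
      fix x assume x: "x \<in> X"
      show "0 \<le> real N * s i x" using d by (auto simp: s_def)
      have "real N * s i x \<le> real N * d" by (intro mult_left_mono) (auto simp: s_def)
      then show "real N * s i x \<le> 1" using d by simp
      show "real N * s i x = 0" if "x \<notin> U i" using that x d by (auto simp: s_def U_def)
    qed
    from le_content[OF this] have "real N * L (s i) \<le> content (U i)"
      by (simp add: cmult lips)
    then show "L (s i) \<le> d * measure rep_measure (U i)"
      using N by (simp add: measure_rep_measure_openin U d_def field_simps)
  qed
  also have "\<dots> = (\<Sum>i<N. \<integral>x. d * indicator (U i) x \<partial>rep_measure)"
    by (simp add: sets_rep_measure openin_in_sets_borel_on[OF U])
  also have "\<dots> = (\<integral>x. (\<Sum>i<N. d * indicator (U i) x) \<partial>rep_measure)"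
    by (rule Bochner_Integration.integral_sum[symmetric]) (rule intU)
  \<comment> \<open>The step function overshoots \<open>f\<close> by at most \<open>d\<close>, whose
    integral is the error term \<open>L (\<lambda>_. 1) / N\<close>.\<close>
  also have "\<dots> \<le> (\<integral>x. f x + d \<partial>rep_measure)"
  proof (intro integral_mono)
    show "integrable rep_measure (\<lambda>x. \<Sum>i<N. d * indicator (U i) x)"
      by (rule Bochner_Integration.integrable_sum) (rule intU)
    show "integrable rep_measure (\<lambda>x. f x + d)"
      using integrable_rep_measure[OF lip] by simp
    fix x assume "x \<in> space rep_measure"
    then have x: "x \<in> X" by (simp add: space_rep_measure)
    have "(\<Sum>i<N. d * indicator (U i) x) = (\<Sum>i<N. if real i * d < f x then d else 0)"
      using x by (intro sum.cong) (auto simp: U_def indicator_def)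
    also have "\<dots> \<le> f x + d"
      using sum_levels_le[of "f x" d N] f[OF x] d by simp
    finally show "(\<Sum>i<N. d * indicator (U i) x) \<le> f x + d" .
  qed
  also have "\<dots> = (\<integral>x. f x \<partial>rep_measure) + d * L (\<lambda>_. 1)"
    using integrable_rep_measure[OF lip]
    by (simp add: space_rep_measure measure_rep_measure_openin content_space)
  finally show ?thesis by (simp add: d_def)
qed

lemma le_integral_rep_measure:
  assumes lip: "is_lipschitz_on X f" and f: "\<And>x. x \<in> X \<Longrightarrow> 0 \<le> f x" "\<And>x. x \<in> X \<Longrightarrow> f x \<le> 1"
  shows "L f \<le> (\<integral>x. f x \<partial>rep_measure)"
proof (rule LIMSEQ_le_const)
  show "(\<lambda>N. (\<integral>x. f x \<partial>rep_measure) + L (\<lambda>_. 1) / real N) \<longlonglongrightarrow> (\<integral>x. f x \<partial>rep_measure)"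
    using tendsto_add[OF tendsto_const lim_const_over_n] by fastforce
  show "\<exists>N. \<forall>n\<ge>N. L f \<le> (\<integral>x. f x \<partial>rep_measure) + L (\<lambda>_. 1) / real n"
    using le_integral_rep_measure_aux[OF assms] by (intro exI[of _ 1]) auto
qed

text \<open>Only one inequality is known so far. For values in the unit interval the other follows
  by applying it to \<open>1 - h\<close>, because \<open>L\<close> and the measure agree on
  constants. A general \<open>f\<close> is an affine image of such an \<open>h\<close>.\<close>

theorem integral_rep_measure:
  assumes lip: "is_lipschitz_on X f"
  shows "L f = (\<integral>x. f x \<partial>rep_measure)"
proof -
  interpret finite_measure rep_measure by (rule finite_measure_rep_measure)
  have L1: "L (\<lambda>_. 1) = measure rep_measure X"
    by (simp add: measure_rep_measure_openin content_space)
  have *: "L h = (\<integral>x. h x \<partial>rep_measure)"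
    if lip: "is_lipschitz_on X h" and h: "\<And>x. x \<in> X \<Longrightarrow> 0 \<le> h x" "\<And>x. x \<in> X \<Longrightarrow> h x \<le> 1" for h
  proof -
    have "L (\<lambda>x. 1 + (-1) * h x) \<le> (\<integral>x. 1 + (-1) * h x \<partial>rep_measure)"
      using h by (intro le_integral_rep_measure is_lipschitz_on_add is_lipschitz_on_cmult
          is_lipschitz_on_const lip) auto
    moreover have "L (\<lambda>x. 1 + (-1) * h x) = L (\<lambda>_. 1) + (-1) * L h"
      by (subst add) (simp_all only: is_lipschitz_on_const is_lipschitz_on_cmult lip cmult)
    moreover have "(\<integral>x. 1 + (-1) * h x \<partial>rep_measure) = L (\<lambda>_. 1) - (\<integral>x. h x \<partial>rep_measure)"
      using integrable_rep_measure[OF lip] by (simp add: L1 space_rep_measure)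
    ultimately show ?thesis using le_integral_rep_measure[OF that] by simp
  qed
  obtain B where B: "B > 0" "\<And>x. x \<in> X \<Longrightarrow> \<bar>f x\<bar> \<le> B"
    using is_lipschitz_on_bounded[OF compact lip] by blast
  define h where "h = (\<lambda>x. 1 / 2 + (1 / (2 * B)) * f x)"
  have fh: "f x = - B + 2 * B * h x" for x
    using B by (simp add: h_def field_simps)
  have liph: "is_lipschitz_on X h"
    unfolding h_def by (intro is_lipschitz_on_add is_lipschitz_on_cmult is_lipschitz_on_const lip)
  have "0 \<le> h x \<and> h x \<le> 1" if "x \<in> X" for x
    using B(1) B(2)[OF that] by (auto simp: h_def field_simps)
  then have Lh: "L h = (\<integral>x. h x \<partial>rep_measure)" using * liph by blast
  have "L f = L (\<lambda>x. - B + 2 * B * h x)" using fh by presburger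
  also have "\<dots> = - B * L (\<lambda>_. 1) + 2 * B * L h"
    by (subst add) (simp_all add: is_lipschitz_on_const is_lipschitz_on_cmult liph cmult const[of "- B"])
  also have "\<dots> = (\<integral>x. - B + 2 * B * h x \<partial>rep_measure)"
    using integrable_rep_measure[OF liph] by (simp add: Lh L1 space_rep_measure)
  also have "\<dots> = (\<integral>x. f x \<partial>rep_measure)" using fh by presburger
  finally show ?thesis .
qed

end

section \<open>Integration against differences of finite measures\<close>

text \<open>For \<open>f\<close> in \<open>[0, 1)\<close> this is where the digit of weight
  \<open>(1/2) ^ Suc k\<close> is 1; \<open>Suc k\<close> skips the integer part. Integrals against
  any finite measure become series with these same sets and weights, so they are governed by values
  on sets alone, and the same series makes sense with operators in place of numbers.\<close>

definition binary_digit_set :: "'a measure \<Rightarrow> ('a \<Rightarrow> real) \<Rightarrow> nat \<Rightarrow> 'a set"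
  where "binary_digit_set M f k = {x\<in>space M. odd \<lfloor>2 ^ Suc k * f x\<rfloor>}"

lemma binary_digit_set_measurable [measurable]:
  assumes [measurable]: "f \<in> borel_measurable M"
  shows "binary_digit_set M f k \<in> sets M"
  unfolding binary_digit_set_def by measurable

text \<open>Doubling shifts the binary point: the integer part gains one new last digit.\<close>

lemma floor_double: "\<lfloor>2 * y\<rfloor> = 2 * \<lfloor>y\<rfloor> + of_bool (odd \<lfloor>2 * y\<rfloor>)" for y :: real
proof -
  have "\<lfloor>2 * y\<rfloor> = 2 * \<lfloor>y\<rfloor> \<or> \<lfloor>2 * y\<rfloor> = 2 * \<lfloor>y\<rfloor> + 1" by linarith
  then show ?thesis by auto
qed

lemma sum_binary_digits:
  fixes t :: real
  assumes "0 \<le> t" "t < 1"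
  shows "(\<Sum>k<n. (1/2 :: real) ^ Suc k * of_bool (odd \<lfloor>2 ^ Suc k * t\<rfloor>)) = of_int \<lfloor>2 ^ n * t\<rfloor> / 2 ^ n"
proof (induction n)
  case 0
  have "\<lfloor>t\<rfloor> = 0" using assms by linarith
  then show ?case by simp
next
  case (Suc n)
  have "real_of_int \<lfloor>2 ^ Suc n * t\<rfloor> = 2 * of_int \<lfloor>2 ^ n * t\<rfloor> + of_bool (odd \<lfloor>2 ^ Suc n * t\<rfloor>)"
    using arg_cong[OF floor_double[of "2 ^ n * t"], of real_of_int] by (simp add: mult.assoc)
  then show ?case by (simp only: sum.lessThan_Suc Suc.IH) (simp add: field_simps power_divide)
qed

lemma sums_binary_digits:
  fixes t :: real
  assumes "0 \<le> t" "t < 1"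
  shows "(\<lambda>k. (1/2 :: real) ^ Suc k * of_bool (odd \<lfloor>2 ^ Suc k * t\<rfloor>)) sums t"
proof -
  have "(\<lambda>n. t - of_int \<lfloor>2 ^ n * t\<rfloor> / 2 ^ n) \<longlonglongrightarrow> 0"
  proof (rule tendsto_sandwich[of "\<lambda>_. 0" _ _ "\<lambda>n. (1/2) ^ n"])
    have *: "2 ^ n * t - 1 \<le> of_int \<lfloor>2 ^ n * t\<rfloor>" "of_int \<lfloor>2 ^ n * t\<rfloor> \<le> 2 ^ n * t" for n
      by linarith+
    show "\<forall>\<^sub>F n in sequentially. 0 \<le> t - of_int \<lfloor>2 ^ n * t\<rfloor> / 2 ^ n"
      using *(2) by (auto simp: field_simps)
    show "\<forall>\<^sub>F n in sequentially. t - of_int \<lfloor>2 ^ n * t\<rfloor> / 2 ^ n \<le> (1/2) ^ n"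
    proof (intro always_eventually allI)
      fix n
      have "t * 2 ^ n - of_int \<lfloor>2 ^ n * t\<rfloor> \<le> 1"
        using *(1)[of n] unfolding mult.commute[of t] by linarith
      then show "t - of_int \<lfloor>2 ^ n * t\<rfloor> / 2 ^ n \<le> (1/2) ^ n"
        using divide_right_mono[of _ 1 "2 ^ n :: real"] by (fastforce simp: diff_divide_distrib power_one_over)
    qed
    show "(\<lambda>n. (1/2) ^ n) \<longlonglongrightarrow> (0::real)" by (rule LIMSEQ_power_zero) simp
  qed simp
  from tendsto_diff[OF tendsto_const[of t] this]
  show ?thesis unfolding sums_def sum_binary_digits[OF assms] by simp
qed

lemma sums_binary_digit_set:
  assumes "x \<in> space M" "0 \<le> f x" "f x < 1"
  shows "(\<lambda>k. (1/2) ^ Suc k * indicator (binary_digit_set M f k) x) sums f x"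
  using sums_binary_digits[OF assms(2,3)] assms(1)
  by (simp add: binary_digit_set_def indicator_def)

text \<open>Dominated convergence, as the partial digit sums stay between 0 and \<open>f\<close>.
  The factor \<open>h\<close> is 1 for plain integrals; for squared norms of spectral integrals it
  is first an indicator and then \<open>f\<close> itself.\<close>

lemma integral_binary_digit_sums:
  fixes f h :: "'a \<Rightarrow> real"
  assumes "finite_measure M" and [measurable]: "f \<in> borel_measurable M" "h \<in> borel_measurable M"
    and f: "\<And>x. x \<in> space M \<Longrightarrow> 0 \<le> f x" "\<And>x. x \<in> space M \<Longrightarrow> f x < 1"
    and h: "\<And>x. x \<in> space M \<Longrightarrow> \<bar>h x\<bar> \<le> B"
  shows "(\<lambda>k. (1/2) ^ Suc k * (\<integral>x. indicator (binary_digit_set M f k) x * h x \<partial>M))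
    sums (\<integral>x. f x * h x \<partial>M)"
proof -
  interpret finite_measure M by fact
  let ?A = "binary_digit_set M f"
  let ?s = "\<lambda>n x. (\<Sum>k<n. (1/2) ^ Suc k * (indicator (?A k) x * h x))"
  have int: "integrable M (\<lambda>x. indicator (?A k) x * h x)" for k
  proof (rule integrable_const_bound[of _ B])
    show "AE x in M. norm (indicator (?A k) x * h x) \<le> B"
      using h by (intro AE_I2) (fastforce simp: indicator_def)
  qed simp
  have lim: "(\<lambda>n. ?s n x) \<longlonglongrightarrow> f x * h x" if "x \<in> space M" for x
    using sums_mult2[OF sums_binary_digit_set[of x M f, OF that f[OF that]], of "h x"]
    by (simp add: sums_def mult.assoc)
  have "(\<lambda>n. \<integral>x. ?s n x \<partial>M) \<longlonglongrightarrow> (\<integral>x. f x * h x \<partial>M)"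
  proof (rule integral_dominated_convergence[where w = "\<lambda>_. B"])
    show "AE x in M. (\<lambda>n. ?s n x) \<longlonglongrightarrow> f x * h x"
      using lim by (intro AE_I2)
    show "AE x in M. norm (?s n x) \<le> B" for n
    proof (intro AE_I2)
      fix x assume x: "x \<in> space M"
      let ?t = "\<Sum>k<n. (1/2 :: real) ^ Suc k * indicator (?A k) x"
      have "?t \<le> f x"
        using sums_binary_digit_set[of x M f, OF x f[OF x]]
        by (metis (no_types, lifting) sum_le_suminf sums_iff finite_lessThan indicator_pos_le
            mult_nonneg_nonneg zero_le_divide_1_iff zero_le_numeral zero_le_power)
      moreover have "0 \<le> ?t" by (intro sum_nonneg) auto
      ultimately have t: "\<bar>?t\<bar> \<le> 1" using f[OF x] by linarith
      have "norm (?s n x) = \<bar>?t\<bar> * \<bar>h x\<bar>"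
        by (simp add: abs_mult[symmetric] sum_distrib_right mult.assoc)
      also have "\<dots> \<le> 1 * B" using t h[OF x] by (intro mult_mono) auto
      finally show "norm (?s n x) \<le> B" by simp
    qed
  qed auto
  moreover have "(\<integral>x. ?s n x \<partial>M) = (\<Sum>k<n. (1/2) ^ Suc k * (\<integral>x. indicator (?A k) x * h x \<partial>M))" for n
    by (subst Bochner_Integration.integral_sum) (simp_all add: int)
  ultimately show ?thesis by (simp add: sums_def)
qed

lemma integral_binary_digit_sums_measure:
  fixes f :: "'a \<Rightarrow> real"
  assumes "finite_measure M" and [measurable]: "f \<in> borel_measurable M"
    and f: "\<And>x. x \<in> space M \<Longrightarrow> 0 \<le> f x" "\<And>x. x \<in> space M \<Longrightarrow> f x < 1"
  shows "(\<lambda>k. (1/2) ^ Suc k * measure M (binary_digit_set M f k)) sums (\<integral>x. f x \<partial>M)"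
proof -
  interpret finite_measure M by fact
  show ?thesis
    using integral_binary_digit_sums[OF assms(1,2), of "\<lambda>_. 1" 1] f
    by (simp add: sets.Int_space_eq2)
qed

lemma integrable_bounded:
  fixes f :: "'a \<Rightarrow> real"
  assumes "finite_measure M" "f \<in> borel_measurable M" "\<And>x. x \<in> space M \<Longrightarrow> \<bar>f x\<bar> \<le> B"
  shows "integrable M f"
  using assms by (intro finite_measure.integrable_const_bound[of M _ B]) auto

lemma bounded_normalize:
  fixes f :: "'a \<Rightarrow> real"
  assumes "\<And>x. x \<in> S \<Longrightarrow> \<bar>f x\<bar> \<le> B"
  obtains g a b where "\<And>x. f x = a * g x + b" "\<And>x. g x = (f x - b) / a"
    "\<And>x. x \<in> S \<Longrightarrow> 0 \<le> g x" "\<And>x. x \<in> S \<Longrightarrow> g x < 1"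
proof -
  \<comment> \<open>The added 1 yields the strict bound \<open>g x < 1\<close>, and the absolute
    value keeps \<open>C\<close> positive even if \<open>S\<close> is empty and \<open>B\<close>
    negative.\<close>
  define C where "C = \<bar>B\<bar> + 1"
  have C: "C > 0" "\<And>x. x \<in> S \<Longrightarrow> \<bar>f x\<bar> < C" using assms by (force simp: C_def)+
  show ?thesis
  proof (rule that[of "2 * C" "\<lambda>x. (f x - - C) / (2 * C)" "- C"])
    fix x
    show "f x = 2 * C * ((f x - - C) / (2 * C)) + - C" using C(1) by (simp add: field_simps)
    show "0 \<le> (f x - - C) / (2 * C)" "(f x - - C) / (2 * C) < 1" if "x \<in> S"
      using C(1) C(2)[OF that] by (auto simp: field_simps)
  qed simp
qed

text \<open>An integral against a signed measure does not depend on how the latter is split into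
  finite measures. After normalizing \<open>f\<close> to \<open>[0, 1)\<close>, all four integrals
  are digit series over the same sets \<open>?A k\<close>, so the hypothesis applies term by term;
  applied to the whole space it settles the constant \<open>b\<close>.\<close>

lemma integral_diff_cong_measure:
  fixes f :: "'a \<Rightarrow> real"
  assumes fin: "finite_measure M1" "finite_measure M2" "finite_measure N1" "finite_measure N2"
    and sets: "sets M2 = sets M1" "sets N1 = sets M1" "sets N2 = sets M1"
    and eq: "\<And>A. A \<in> sets M1 \<Longrightarrow> measure M1 A - measure M2 A = measure N1 A - measure N2 A"
    and f: "f \<in> borel_measurable M1" "\<And>x. x \<in> space M1 \<Longrightarrow> \<bar>f x\<bar> \<le> B"
  shows "(\<integral>x. f x \<partial>M1) - (\<integral>x. f x \<partial>M2) = (\<integral>x. f x \<partial>N1) - (\<integral>x. f x \<partial>N2)"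
proof -
  obtain g a b where g: "\<And>x. f x = a * g x + b" "\<And>x. g x = (f x - b) / a"
    "\<And>x. x \<in> space M1 \<Longrightarrow> 0 \<le> g x" "\<And>x. x \<in> space M1 \<Longrightarrow> g x < 1"
    using bounded_normalize[of "space M1" f B] f(2) by metis
  let ?A = "binary_digit_set M1 g"
  have mg: "g \<in> borel_measurable M1"
    unfolding g(2)[abs_def] using f(1) by measurable
  have A: "?A k \<in> sets M1" for k using mg by (rule binary_digit_set_measurable)
  have *: "(\<lambda>k. (1/2) ^ Suc k * measure N (?A k)) sums (\<integral>x. g x \<partial>N) \<and>
      (\<integral>x. f x \<partial>N) = a * (\<integral>x. g x \<partial>N) + b * measure N (space M1)"
    if N: "finite_measure N" "sets N = sets M1" for N
  proof -
    have sp: "space N = space M1" using N(2) by (rule sets_eq_imp_space_eq)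
    have mg': "g \<in> borel_measurable N" using mg N(2) by (simp cong: measurable_cong_sets)
    interpret finite_measure N by fact
    have "integrable N g"
      using g(3,4) by (intro integrable_bounded[OF N(1) mg', of 1]) (fastforce simp: sp)
    then have "(\<integral>x. f x \<partial>N) = a * (\<integral>x. g x \<partial>N) + b * measure N (space M1)"
      unfolding g(1) by (simp add: sp)
    moreover have "?A k = binary_digit_set N g k" for k
      by (simp add: binary_digit_set_def sp)
    ultimately show ?thesis
      using integral_binary_digit_sums_measure[OF N(1) mg'] g(3,4) by (simp add: sp)
  qed
  have "(\<lambda>k. (1/2) ^ Suc k * measure M1 (?A k) - (1/2) ^ Suc k * measure M2 (?A k)) sums
      ((\<integral>x. g x \<partial>M1) - (\<integral>x. g x \<partial>M2))"
    using * fin sets by (intro sums_diff) auto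
  moreover have "(\<lambda>k. (1/2) ^ Suc k * measure N1 (?A k) - (1/2) ^ Suc k * measure N2 (?A k)) sums
      ((\<integral>x. g x \<partial>N1) - (\<integral>x. g x \<partial>N2))"
    using * fin sets by (intro sums_diff) auto
  moreover have "(1/2) ^ Suc k * measure M1 (?A k) - (1/2) ^ Suc k * measure M2 (?A k) =
      (1/2) ^ Suc k * measure N1 (?A k) - (1/2) ^ Suc k * measure N2 (?A k)" for k
    using eq[OF A[of k]] by (metis right_diff_distrib)
  ultimately have "(\<integral>x. g x \<partial>M1) - (\<integral>x. g x \<partial>M2) = (\<integral>x. g x \<partial>N1) - (\<integral>x. g x \<partial>N2)"
    using sums_unique2 by simp
  then have "a * (\<integral>x. g x \<partial>M1) - a * (\<integral>x. g x \<partial>M2) = a * (\<integral>x. g x \<partial>N1) - a * (\<integral>x. g x \<partial>N2)"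
    by (metis right_diff_distrib)
  moreover have "b * measure M1 (space M1) - b * measure M2 (space M1) =
      b * measure N1 (space M1) - b * measure N2 (space M1)"
    using eq[of "space M1"] by (metis right_diff_distrib sets.top)
  ultimately show ?thesis
    using * fin sets by simp
qed

section \<open>Jordan parts of a difference of finite measures\<close>

text \<open>\<open>Y\<close> is the positive set of a Hahn decomposition. The supremum in the
  definition is then a maximum, attained at \<open>A \<inter> Y\<close>, and countable additivity is
  inherited from \<open>\<nu>\<close>.\<close>

lemma emeasure_positive_part_measure:
  assumes fin: "finite_measure M1" "finite_measure M2" and sets: "sets M1 = sets M" "sets M2 = sets M"
    and nu: "\<And>A. A \<in> sets M \<Longrightarrow> \<nu> A = measure M1 A - measure M2 A"
    and Y: "Y \<in> sets M" "\<And>B. B \<in> sets M \<Longrightarrow> B \<subseteq> Y \<Longrightarrow> measure M2 B \<le> measure M1 B"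
      "\<And>B. B \<in> sets M \<Longrightarrow> B \<inter> Y = {} \<Longrightarrow> measure M1 B \<le> measure M2 B"
    and A: "A \<in> sets M"
  shows "emeasure (positive_part_measure M \<nu>) A = ennreal (\<nu> (A \<inter> Y))"
proof -
  interpret M1: finite_measure M1 by fact
  interpret M2: finite_measure M2 by fact
  have add: "\<nu> (B \<union> C) = \<nu> B + \<nu> C" if "B \<in> sets M" "C \<in> sets M" "B \<inter> C = {}" for B C
    using that by (simp add: nu sets M1.finite_measure_Union M2.finite_measure_Union)
  have pos: "0 \<le> \<nu> B" if "B \<in> sets M" "B \<subseteq> Y" for B
    using Y(2)[OF that] that by (simp add: nu)
  have neg: "\<nu> B \<le> 0" if "B \<in> sets M" "B \<inter> Y = {}" for B
    using Y(3)[OF that] that by (simp add: nu)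
  have sup: "(SUP B\<in>{B \<in> sets M. B \<subseteq> A}. \<nu> B) = \<nu> (A \<inter> Y)" if A: "A \<in> sets M" for A
  proof (rule cSup_eq_maximum)
    show "\<nu> (A \<inter> Y) \<in> \<nu> ` {B \<in> sets M. B \<subseteq> A}" using A Y(1) by auto
    fix r assume "r \<in> \<nu> ` {B \<in> sets M. B \<subseteq> A}"
    then obtain B where B: "B \<in> sets M" "B \<subseteq> A" "r = \<nu> B" by auto
    have "\<nu> B = \<nu> (B \<inter> Y) + \<nu> (B - Y)"
      using B Y(1) by (subst add[symmetric]) (auto simp: Int_Diff_Un)
    \<comment> \<open>Discarding the part of \<open>B\<close> outside \<open>Y\<close> and adding
      the rest of \<open>A\<close> inside \<open>Y\<close> can only increase
      \<open>\<nu>\<close>.\<close>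
    also have "\<dots> \<le> \<nu> (B \<inter> Y) + \<nu> ((A - B) \<inter> Y)"
    proof -
      have "\<nu> (B - Y) \<le> 0" using B Y(1) by (intro neg) auto
      moreover have "0 \<le> \<nu> ((A - B) \<inter> Y)" using A B Y(1) by (intro pos) auto
      ultimately show ?thesis by simp
    qed
    also have "\<dots> = \<nu> ((B \<inter> Y) \<union> ((A - B) \<inter> Y))"
      using A B Y(1) by (subst add) auto
    also have "(B \<inter> Y) \<union> ((A - B) \<inter> Y) = A \<inter> Y" using B by auto
    finally show "r \<le> \<nu> (A \<inter> Y)" using B by simp
  qed
  have "emeasure (positive_part_measure M \<nu>) A = ennreal (SUP B\<in>{B \<in> sets M. B \<subseteq> A}. \<nu> B)"
    unfolding positive_part_measure_def
  proof (rule emeasure_measure_of_sigma)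
    show "sigma_algebra (space M) (sets M)" ..
    show "positive (sets M) (\<lambda>A. ennreal (SUP B\<in>{B \<in> sets M. B \<subseteq> A}. \<nu> B))"
      using sup[of "{}"] by (simp add: positive_def nu)
    show "countably_additive (sets M) (\<lambda>A. ennreal (SUP B\<in>{B \<in> sets M. B \<subseteq> A}. \<nu> B))"
      unfolding countably_additive_def
    proof safe
      fix B :: "nat \<Rightarrow> 'a set"
      assume B: "range B \<subseteq> sets M" "disjoint_family B" "\<Union> (range B) \<in> sets M"
      have BY: "range (\<lambda>i. B i \<inter> Y) \<subseteq> sets M" "disjoint_family (\<lambda>i. B i \<inter> Y)"
        using B Y(1) by (auto simp: disjoint_family_on_def)
      have "(\<lambda>i. measure M1 (B i \<inter> Y) - measure M2 (B i \<inter> Y)) sums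
          (measure M1 (\<Union>i. B i \<inter> Y) - measure M2 (\<Union>i. B i \<inter> Y))"
        using BY by (intro sums_diff M1.finite_measure_UNION M2.finite_measure_UNION)
          (auto simp: sets)
      then have "(\<lambda>i. \<nu> (B i \<inter> Y)) sums \<nu> (\<Union>i. B i \<inter> Y)"
        using BY B Y(1) by (subst (1 2) nu) (auto simp: image_subset_iff simp del: UN_simps)
      then have "(\<Sum>i. ennreal (\<nu> (B i \<inter> Y))) = ennreal (\<nu> (\<Union>i. B i \<inter> Y))"
        using BY by (intro suminf_ennreal_eq pos) (auto simp: image_subset_iff)
      then show "(\<Sum>i. ennreal (SUP C\<in>{C \<in> sets M. C \<subseteq> B i}. \<nu> C)) =
          ennreal (SUP C\<in>{C \<in> sets M. C \<subseteq> \<Union> (range B)}. \<nu> C)"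
        using B by (simp add: sup image_subset_iff)
    qed
  qed fact
  then show ?thesis by (simp add: sup A)
qed

text \<open>Lets the integral be computed from whatever splitting of \<open>\<nu>\<close> is at
  hand, such as the one that polarization produces: the Jordan parts are a second splitting, and
  \<open>integral_diff_cong_measure\<close> compares the two.\<close>

lemma signed_measure_integral_diff:
  assumes fin: "finite_measure M1" "finite_measure M2" and sets: "sets M1 = sets M" "sets M2 = sets M"
    and nu: "\<And>A. A \<in> sets M \<Longrightarrow> \<nu> A = measure M1 A - measure M2 A"
    and f: "f \<in> borel_measurable M" "\<And>x. x \<in> space M \<Longrightarrow> \<bar>f x\<bar> \<le> B"
  shows "signed_measure_integral M \<nu> (\<lambda>x. complex_of_real (f x)) =
    complex_of_real ((\<integral>x. f x \<partial>M1) - (\<integral>x. f x \<partial>M2))"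
proof -
  interpret M1: finite_measure M1 by fact
  interpret M2: finite_measure M2 by fact
  obtain Y where Y: "Y \<in> sets M" "\<And>B. B \<in> sets M \<Longrightarrow> B \<subseteq> Y \<Longrightarrow> measure M2 B \<le> measure M1 B"
      "\<And>B. B \<in> sets M \<Longrightarrow> B \<inter> Y = {} \<Longrightarrow> measure M1 B \<le> measure M2 B"
  proof -
    obtain Y where Y: "Y \<in> sets M1" "\<forall>B\<in>sets M1. B \<subseteq> Y \<longrightarrow> emeasure M2 B \<le> emeasure M1 B"
        "\<forall>B\<in>sets M1. B \<inter> Y = {} \<longrightarrow> emeasure M1 B \<le> emeasure M2 B"
      using finite_unsigned_Hahn_decomposition[OF fin trans[OF sets(2) sets(1)[symmetric]]] by blast
    show ?thesis
    proof (rule that)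
      show "Y \<in> sets M" using Y(1) by (simp only: sets)
      show "measure M2 B \<le> measure M1 B" if "B \<in> sets M" "B \<subseteq> Y" for B
        using Y(2) that by (simp add: sets M1.emeasure_eq_measure M2.emeasure_eq_measure)
      show "measure M1 B \<le> measure M2 B" if "B \<in> sets M" "B \<inter> Y = {}" for B
        using Y(3) that by (simp add: sets M1.emeasure_eq_measure M2.emeasure_eq_measure)
    qed
  qed
  let ?P = "positive_part_measure M \<nu>" and ?N = "positive_part_measure M (\<lambda>A. - \<nu> A)"
  have P: "emeasure ?P A = ennreal (\<nu> (A \<inter> Y))" if "A \<in> sets M" for A
    by (rule emeasure_positive_part_measure[where ?M1.0 = M1 and ?M2.0 = M2])
      (fact fin sets nu Y that)+
  have Yc: "space M - Y \<in> sets M" "\<And>B. B \<in> sets M \<Longrightarrow> B \<subseteq> space M - Y \<Longrightarrow> measure M1 B \<le> measure M2 B"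
      "\<And>B. B \<in> sets M \<Longrightarrow> B \<inter> (space M - Y) = {} \<Longrightarrow> measure M2 B \<le> measure M1 B"
  proof -
    fix B assume B: "B \<in> sets M"
    show "measure M1 B \<le> measure M2 B" if "B \<subseteq> space M - Y"
      using that by (intro Y(3) B) auto
    show "measure M2 B \<le> measure M1 B" if "B \<inter> (space M - Y) = {}"
      using that sets.sets_into_space[OF B] by (intro Y(2) B) auto
  qed (use Y(1) in auto)
  \<comment> \<open>The negative part is the positive part for the swapped measures, with the
    complement of \<open>Y\<close> as its positive set.\<close>
  have N: "emeasure ?N A = ennreal (- \<nu> (A \<inter> (space M - Y)))" if "A \<in> sets M" for A
  proof (rule emeasure_positive_part_measure[where ?M1.0 = M2 and ?M2.0 = M1])
    show "- \<nu> B = measure M2 B - measure M1 B" if "B \<in> sets M" for B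
      using nu[OF that] by simp
  qed (fact fin sets Yc that)+
  have setsPN: "sets ?P = sets M" "sets ?N = sets M"
    by (simp_all add: positive_part_measure_def sets.space_closed sets.sigma_sets_eq)
  have spPN: "space ?P = space M" "space ?N = space M"
    using setsPN by (auto dest: sets_eq_imp_space_eq)
  have finPN: "finite_measure ?P" "finite_measure ?N"
    by (auto intro!: finite_measureI simp: spPN P N)
  have mP: "measure ?P A = \<nu> (A \<inter> Y)" if "A \<in> sets M" for A
    using Y(1) Y(2)[of "A \<inter> Y"] that by (simp add: measure_def P nu)
  have mN: "measure ?N A = - \<nu> (A \<inter> (space M - Y))" if "A \<in> sets M" for A
    using Yc(1) Yc(2)[of "A \<inter> (space M - Y)"] that by (simp add: measure_def N nu)
  have eq: "measure ?P A - measure ?N A = measure M1 A - measure M2 A" if A: "A \<in> sets ?P" for A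
  proof -
    have A': "A \<in> sets M" using A by (simp add: setsPN)
    have "A = (A \<inter> Y) \<union> (A \<inter> (space M - Y))" using sets.sets_into_space[OF A'] by auto
    then have "measure M1 A = measure M1 (A \<inter> Y) + measure M1 (A \<inter> (space M - Y))"
      "measure M2 A = measure M2 (A \<inter> Y) + measure M2 (A \<inter> (space M - Y))"
      using A' Y(1) Yc(1)
        M1.finite_measure_Union[of "A \<inter> Y" "A \<inter> (space M - Y)"]
        M2.finite_measure_Union[of "A \<inter> Y" "A \<inter> (space M - Y)"]
      by (auto simp: sets)
    then show ?thesis using A' Y(1) Yc(1) by (simp add: mP mN nu)
  qed
  have "(\<integral>x. f x \<partial>?P) - (\<integral>x. f x \<partial>?N) = (\<integral>x. f x \<partial>M1) - (\<integral>x. f x \<partial>M2)"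
  proof (rule integral_diff_cong_measure[OF finPN fin _ _ _ eq])
    show "f \<in> borel_measurable ?P" using f(1) setsPN by (simp cong: measurable_cong_sets)
  qed (use f(2) in \<open>auto simp: setsPN sets spPN\<close>)
  then show ?thesis
    by (simp add: signed_measure_integral_def of_real_diff[symmetric] del: of_real_diff)
qed

section \<open>Spectral integrals\<close>

text \<open>Being real bilinear, it gives access to the \<open>bounded_bilinear\<close> facts.
  Nothing is lost, since the imaginary part is recovered by rotating the second argument, see
  \<open>Im_cinner\<close>.\<close>

definition rinner :: "'h::complex_hilbert_space \<Rightarrow> 'h \<Rightarrow> real"
  where "rinner x y = Re (cinner x y)"

lemma cinner_add_right: "cinner x (y + z) = cinner x y + cinner x (z :: 'h::complex_hilbert_space)"
  by (simp add: cinner_commute[of x] cinner_add_left)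

lemma cinner_scaleC_right: "cinner x (c *\<^sub>C y) = cnj c * cinner x (y :: 'h::complex_hilbert_space)"
  by (simp add: cinner_commute[of x] cinner_scaleC_left)

lemma rinner_commute: "rinner x y = rinner y x"
  unfolding rinner_def by (subst cinner_commute) simp

lemma rinner_add_left: "rinner (x + y) z = rinner x z + rinner y z"
  by (simp add: rinner_def cinner_add_left)

lemma rinner_add_right: "rinner x (y + z) = rinner x y + rinner x z"
  by (simp add: rinner_def cinner_add_right)

lemma rinner_scaleR_left: "rinner (r *\<^sub>R x) y = r * rinner x y"
  by (simp add: rinner_def scaleR_scaleC cinner_scaleC_left)

lemma rinner_scaleR_right: "rinner x (r *\<^sub>R y) = r * rinner x y"
  by (simp add: rinner_def scaleR_scaleC cinner_scaleC_right)

lemma rinner_self: "rinner x x = (norm x)\<^sup>2"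
proof -
  have "0 \<le> Re (cinner x x)" using norm_ge_zero[of x] by (simp add: norm_eq_sqrt_cinner)
  then show ?thesis by (simp add: rinner_def norm_eq_sqrt_cinner)
qed

lemma norm_add_sq: "(norm (x + y))\<^sup>2 = (norm x)\<^sup>2 + 2 * rinner x y + (norm y)\<^sup>2"
  for x y :: "'h::complex_hilbert_space"
  by (simp add: rinner_self[symmetric] rinner_add_left rinner_add_right rinner_commute[of y x])

text \<open>Cauchy-Schwarz in the direction opposite to the customary one: the triangle inequality
  is given with the norm, and squaring it leaves exactly this.\<close>

lemma rinner_le_norm: "rinner x y \<le> norm x * norm y"
proof -
  have "(norm (x + y))\<^sup>2 \<le> (norm x + norm y)\<^sup>2"
    by (intro power_mono norm_triangle_ineq) auto
  then show ?thesis by (simp add: norm_add_sq power2_sum)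
qed

lemma bounded_bilinear_rinner: "bounded_bilinear (rinner :: 'h::complex_hilbert_space \<Rightarrow> 'h \<Rightarrow> real)"
proof (unfold_locales, goal_cases)
  case 5
  have "\<bar>rinner a b\<bar> \<le> norm a * norm b * 1" for a b :: 'h
  proof -
    have "- rinner a b = rinner ((-1) *\<^sub>R a) b" by (simp only: rinner_scaleR_left)
    also have "\<dots> \<le> norm ((-1) *\<^sub>R a) * norm b" by (rule rinner_le_norm)
    finally have "- rinner a b \<le> norm a * norm b" by simp
    then show ?thesis using rinner_le_norm[of a b] by simp
  qed
  then show ?case by (auto intro!: exI[of _ 1])
qed (simp_all add: rinner_add_left rinner_add_right rinner_scaleR_left rinner_scaleR_right)

lemmas tendsto_rinner = bounded_bilinear.tendsto[OF bounded_bilinear_rinner]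
  and rinner_diff_left = bounded_bilinear.diff_left[OF bounded_bilinear_rinner]
  and rinner_diff_right = bounded_bilinear.diff_right[OF bounded_bilinear_rinner]
  and rinner_zero_right = bounded_bilinear.zero_right[OF bounded_bilinear_rinner]
  and rinner_zero_left = bounded_bilinear.zero_left[OF bounded_bilinear_rinner]
  and sums_rinner_left = bounded_linear.sums[OF bounded_bilinear.bounded_linear_left[OF bounded_bilinear_rinner]]

lemma Im_cinner: "Im (cinner x y) = rinner x (\<i> *\<^sub>C y)"
  by (simp add: rinner_def cinner_scaleC_right)

lemma rinner_eqI:
  fixes x x' :: "'h::complex_hilbert_space"
  assumes "\<And>y. rinner x y = rinner x' y"
  shows "x = x'"
proof -
  have "rinner (x - x') (x - x') = 0" using assms by (simp add: rinner_diff_left)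
  then show ?thesis by (simp add: rinner_self)
qed

lemma norm_scaleC: "norm (c *\<^sub>C x) = cmod c * norm (x :: 'h::complex_hilbert_space)"
proof -
  have "Im (cinner x x) = 0" using cinner_commute[of x x] by (metis Reals_cnj_iff complex_is_Real_iff)
  then have "rinner (c *\<^sub>C x) (c *\<^sub>C x) = (cmod c)\<^sup>2 * rinner x x"
    unfolding cmod_power2
    by (simp add: rinner_def cinner_scaleC_left cinner_scaleC_right power2_eq_square algebra_simps)
  then have "(norm (c *\<^sub>C x))\<^sup>2 = (cmod c * norm x)\<^sup>2"
    by (simp add: rinner_self power_mult_distrib)
  then show ?thesis by (simp add: power2_eq_iff_nonneg)
qed

lemma bounded_linear_scaleC: "bounded_linear (\<lambda>x :: 'h::complex_hilbert_space. c *\<^sub>C x)"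
proof (rule bounded_linear_intro[of _ "cmod c"])
  show "c *\<^sub>C r *\<^sub>R x = r *\<^sub>R c *\<^sub>C x" for r and x :: 'h
    by (simp add: scaleR_scaleC scaleC_scaleC mult.commute)
qed (simp_all add: scaleC_add_right norm_scaleC mult.commute)

definition hermitian_operators :: "('h::complex_hilbert_space \<Rightarrow>\<^sub>L 'h) set"
  where "hermitian_operators =
    {T \<in> bounded_operators. \<forall>x y. rinner (blinfun_apply T x) y = rinner x (blinfun_apply T y)}"

lemma hermitianD: "T \<in> hermitian_operators \<Longrightarrow> rinner (blinfun_apply T x) y = rinner x (blinfun_apply T y)"
  by (simp add: hermitian_operators_def)

lemma hermitian_bounded: "T \<in> hermitian_operators \<Longrightarrow> T \<in> bounded_operators"
  by (simp add: hermitian_operators_def)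

lemma orthogonal_projections_iff:
  "P \<in> orthogonal_projections \<longleftrightarrow> P \<in> hermitian_operators \<and> P o\<^sub>L P = P"
proof -
  have "cinner (blinfun_apply P x) y = cinner x (blinfun_apply P y)"
    if P: "P \<in> hermitian_operators" for x y
  \<comment> \<open>The real parts agree by hypothesis; the imaginary parts are the same identity at
    \<open>\<i> *\<^sub>C y\<close>, moved through \<open>P\<close> by complex linearity.\<close>
  proof (rule complex_eqI)
    show "Re (cinner (blinfun_apply P x) y) = Re (cinner x (blinfun_apply P y))"
      using hermitianD[OF P, of x y] by (simp add: rinner_def)
    show "Im (cinner (blinfun_apply P x) y) = Im (cinner x (blinfun_apply P y))"
      using hermitianD[OF P, of x "\<i> *\<^sub>C y"] hermitian_bounded[OF P]
      by (simp add: Im_cinner bounded_operators_def)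
  qed
  then show ?thesis
    by (auto simp: orthogonal_projections_def hermitian_operators_def rinner_def)
qed

lemma hermitian_add:
  "S \<in> hermitian_operators \<Longrightarrow> T \<in> hermitian_operators \<Longrightarrow> S + T \<in> hermitian_operators"
  by (simp add: hermitian_operators_def bounded_operators_def blinfun.add_left scaleC_add_right
      rinner_add_left rinner_add_right)

lemma hermitian_scaleR: "T \<in> hermitian_operators \<Longrightarrow> r *\<^sub>R T \<in> hermitian_operators"
  by (simp add: hermitian_operators_def bounded_operators_def blinfun.scaleR_left scaleR_scaleC
      scaleC_scaleC rinner_scaleR_left[unfolded scaleR_scaleC] rinner_scaleR_right[unfolded scaleR_scaleC]
      mult.commute)

lemma hermitian_diff:
  "S \<in> hermitian_operators \<Longrightarrow> T \<in> hermitian_operators \<Longrightarrow> S - T \<in> hermitian_operators"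
  using hermitian_add[of S "(-1) *\<^sub>R T"] hermitian_scaleR[of T "-1"] by simp

lemma hermitian_id: "id_blinfun \<in> hermitian_operators"
  by (simp add: hermitian_operators_def bounded_operators_def)

lemma hermitian_0: "0 \<in> hermitian_operators"
  using hermitian_scaleR[of id_blinfun 0] hermitian_id by simp

text \<open>Pointwise convergence suffices, so the lemma serves both the norm limits
  \<open>T f\<close> and the strong limits that produce projections.\<close>

lemma hermitian_limit:
  assumes T: "\<And>n. T n \<in> hermitian_operators"
    and lim: "\<And>x. (\<lambda>n. blinfun_apply (T n) x) \<longlonglongrightarrow> blinfun_apply S x"
  shows "S \<in> hermitian_operators"
  unfolding hermitian_operators_def bounded_operators_def
proof (intro CollectI conjI allI)
  fix c x
  have "(\<lambda>n. c *\<^sub>C blinfun_apply (T n) x) \<longlonglongrightarrow> c *\<^sub>C blinfun_apply S x"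
    by (intro bounded_linear.tendsto[OF bounded_linear_scaleC] lim)
  moreover have "c *\<^sub>C blinfun_apply (T n) x = blinfun_apply (T n) (c *\<^sub>C x)" for n
    using T[of n] by (simp add: hermitian_operators_def bounded_operators_def)
  ultimately have "(\<lambda>n. blinfun_apply (T n) (c *\<^sub>C x)) \<longlonglongrightarrow> c *\<^sub>C blinfun_apply S x"
    by simp
  with lim show "blinfun_apply S (c *\<^sub>C x) = c *\<^sub>C blinfun_apply S x"
    by (rule LIMSEQ_unique)
next
  fix x y
  have "(\<lambda>n. rinner (blinfun_apply (T n) x) y) \<longlonglongrightarrow> rinner (blinfun_apply S x) y"
    "(\<lambda>n. rinner x (blinfun_apply (T n) y)) \<longlonglongrightarrow> rinner x (blinfun_apply S y)"
    by (intro tendsto_rinner lim tendsto_const)+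
  then show "rinner (blinfun_apply S x) y = rinner x (blinfun_apply S y)"
    unfolding hermitianD[OF T] by (rule LIMSEQ_unique)
qed

text \<open>Placing the factors 1/2 on the vectors removes any prefactor: for projections the
  right-hand side is literally a difference of two scalar measures, the shape that
  \<open>signed_measure_integral_diff\<close> expects.\<close>

lemma hermitian_polarization:
  assumes "T \<in> hermitian_operators"
  shows "rinner (blinfun_apply T x) y =
    rinner (blinfun_apply T ((1/2) *\<^sub>R (x + y))) ((1/2) *\<^sub>R (x + y)) -
    rinner (blinfun_apply T ((1/2) *\<^sub>R (x - y))) ((1/2) *\<^sub>R (x - y))"
proof -
  have "rinner (blinfun_apply T y) x = rinner (blinfun_apply T x) y"
    using hermitianD[OF assms, of y x] by (simp add: rinner_commute)
  then show ?thesis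
    by (simp add: blinfun.scaleR_right blinfun.add_right blinfun.diff_right rinner_scaleR_left
        rinner_scaleR_right rinner_add_left rinner_add_right rinner_diff_left rinner_diff_right field_simps)
qed

lemma hermitian_eqI:
  assumes "S \<in> hermitian_operators" "T \<in> hermitian_operators"
    and "\<And>x. rinner (blinfun_apply S x) x = rinner (blinfun_apply T x) x"
  shows "S = T"
proof (intro blinfun_eqI rinner_eqI)
  fix x y
  show "rinner (blinfun_apply S x) y = rinner (blinfun_apply T x) y"
    unfolding hermitian_polarization[OF assms(1), of x y] hermitian_polarization[OF assms(2), of x y]
      assms(3) ..
qed

lemma projection_rinner:
  assumes "P \<in> orthogonal_projections"
  shows "rinner (blinfun_apply P x) y = rinner (blinfun_apply P x) (blinfun_apply P y)"
  using assms unfolding orthogonal_projections_iff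
  by (metis blinfun_apply_blinfun_compose hermitianD)

lemma projection_norm_sq:
  assumes "P \<in> orthogonal_projections"
  shows "rinner (blinfun_apply P x) x = (norm (blinfun_apply P x))\<^sup>2"
  using projection_rinner[OF assms, of x x] by (simp add: rinner_self)

lemma projection_norm_le:
  assumes "P \<in> orthogonal_projections"
  shows "norm (blinfun_apply P x) \<le> norm x"
proof -
  have "(norm (blinfun_apply P x))\<^sup>2 \<le> norm (blinfun_apply P x) * norm x"
    using rinner_le_norm projection_norm_sq[OF assms] by metis
  then show ?thesis
    by (cases "norm (blinfun_apply P x) = 0") (auto simp: power2_eq_square)
qed

lemma projection_norm_le_1: "P \<in> orthogonal_projections \<Longrightarrow> norm P \<le> 1"
  by (rule norm_blinfun_bound) (simp_all add: projection_norm_le)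

lemma pvmsD:
  assumes "F \<in> pvms X"
  shows "A \<in> sets (borel_on X) \<Longrightarrow> F A \<in> orthogonal_projections"
    and "F {} = 0" "F X = id_blinfun"
    and "A \<in> sets (borel_on X) \<Longrightarrow> B \<in> sets (borel_on X) \<Longrightarrow> F (A \<inter> B) = F A o\<^sub>L F B"
    and "range D \<subseteq> sets (borel_on X) \<Longrightarrow> disjoint_family D \<Longrightarrow>
      (\<lambda>n. blinfun_apply (F (D n)) g) sums blinfun_apply (F (\<Union>n. D n)) g"
  using assms by (auto simp: pvms_def)

section \<open>Scalar measures of a projection-valued measure and existence of spectral
  integrals\<close>

text \<open>This is \<open>F_{g,g}\<close>: for a projection the form at \<open>g\<close> equals the
  squared norm, which is visibly nonnegative.\<close>

definition pvm_measure ::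
    "'x::topological_space set \<Rightarrow> ('x set \<Rightarrow> 'h::complex_hilbert_space \<Rightarrow>\<^sub>L 'h) \<Rightarrow> 'h \<Rightarrow> 'x measure"
  where "pvm_measure X F g =
    measure_of X (sets (borel_on X)) (\<lambda>A. ennreal ((norm (blinfun_apply (F A) g))\<^sup>2))"

lemma sets_pvm_measure: "sets (pvm_measure X F g) = sets (borel_on X)"
  unfolding pvm_measure_def
  using sets.sigma_sets_eq[of "borel_on X"] sets.space_closed[of "borel_on X"]
  by (simp add: space_restrict_space)

lemma space_pvm_measure: "space (pvm_measure X F g) = X"
  using sets_eq_imp_space_eq[OF sets_pvm_measure] by (simp add: space_restrict_space)

lemma space_in_sets_borel_on: "X \<in> sets (borel_on X)"
  using sets.top[of "borel_on X"] by (simp add: space_restrict_space)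

context
  fixes X :: "'x::topological_space set" and F :: "'x set \<Rightarrow> 'h::complex_hilbert_space \<Rightarrow>\<^sub>L 'h"
  assumes F: "F \<in> pvms X"
begin

lemma emeasure_pvm_measure:
  assumes "A \<in> sets (borel_on X)"
  shows "emeasure (pvm_measure X F g) A = ennreal ((norm (blinfun_apply (F A) g))\<^sup>2)"
  unfolding pvm_measure_def
proof (rule emeasure_measure_of_sigma)
  show "sigma_algebra X (sets (borel_on X))"
    using sets.sigma_algebra_axioms[of "borel_on X"] by (simp add: space_restrict_space)
  show "positive (sets (borel_on X)) (\<lambda>A. ennreal ((norm (blinfun_apply (F A) g))\<^sup>2))"
    by (simp add: positive_def pvmsD[OF F])
  show "countably_additive (sets (borel_on X)) (\<lambda>A. ennreal ((norm (blinfun_apply (F A) g))\<^sup>2))"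
    unfolding countably_additive_def
  proof safe
    fix D :: "nat \<Rightarrow> 'x set"
    assume D: "range D \<subseteq> sets (borel_on X)" "disjoint_family D" "\<Union> (range D) \<in> sets (borel_on X)"
    have "(\<lambda>n. rinner (blinfun_apply (F (D n)) g) g) sums rinner (blinfun_apply (F (\<Union>n. D n)) g) g"
      by (intro sums_rinner_left pvmsD(5)[OF F] D)
    moreover have "rinner (blinfun_apply (F A) g) g = (norm (blinfun_apply (F A) g))\<^sup>2"
      if "A \<in> sets (borel_on X)" for A
      using that by (intro projection_norm_sq pvmsD(1)[OF F])
    ultimately have "(\<lambda>n. (norm (blinfun_apply (F (D n)) g))\<^sup>2) sums (norm (blinfun_apply (F (\<Union>n. D n)) g))\<^sup>2"
      using D by (simp add: image_subset_iff)
    then show "(\<Sum>n. ennreal ((norm (blinfun_apply (F (D n)) g))\<^sup>2)) =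
        ennreal ((norm (blinfun_apply (F (\<Union> (range D))) g))\<^sup>2)"
      by (intro suminf_ennreal_eq) auto
  qed
qed fact

lemma measure_pvm_measure:
  "A \<in> sets (borel_on X) \<Longrightarrow> measure (pvm_measure X F g) A = (norm (blinfun_apply (F A) g))\<^sup>2"
  by (simp add: measure_def emeasure_pvm_measure)

lemma measure_pvm_measure_space: "measure (pvm_measure X F g) X = (norm g)\<^sup>2"
  by (simp add: measure_pvm_measure space_in_sets_borel_on pvmsD[OF F])

lemma finite_measure_pvm_measure: "finite_measure (pvm_measure X F g)"
  by (intro finite_measureI) (simp add: space_pvm_measure emeasure_pvm_measure space_in_sets_borel_on)

lemma borel_measurable_pvm_measure:
  "f \<in> borel_measurable (borel_on X) \<Longrightarrow> f \<in> borel_measurable (pvm_measure X F g)"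
  by (simp cong: measurable_cong_sets add: sets_pvm_measure)

text \<open>For \<open>0 \<le> f < 1\<close> the spectral integral is the norm convergent series
  \<open>\<Sum>k. 2 ^ - (k + 1) F (A k)\<close>, where \<open>A k\<close> is the set on which the \<open>k\<close>-th binary digit
  of \<open>f\<close> is \<open>1\<close>.\<close>

lemma spectral_integral_exists_unit:
  fixes f :: "'x \<Rightarrow> real"
  assumes meas: "f \<in> borel_measurable (borel_on X)"
    and f: "\<And>x. x \<in> X \<Longrightarrow> 0 \<le> f x" "\<And>x. x \<in> X \<Longrightarrow> f x < 1"
  shows "\<exists>S\<in>hermitian_operators. \<forall>g.
    rinner (blinfun_apply S g) g = (\<integral>x. f x \<partial>pvm_measure X F g) \<and>
    (norm (blinfun_apply S g))\<^sup>2 = (\<integral>x. (f x)\<^sup>2 \<partial>pvm_measure X F g)"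
proof -
  let ?A = "binary_digit_set (borel_on X) f"
  have A: "?A k \<in> sets (borel_on X)" for k by (rule binary_digit_set_measurable[OF meas])
  have proj: "F (?A k) \<in> orthogonal_projections" for k by (rule pvmsD(1)[OF F A])
  have A_eq: "binary_digit_set (pvm_measure X F g) f = ?A" for g
    by (simp add: fun_eq_iff binary_digit_set_def space_pvm_measure space_restrict_space)
  have "summable (\<lambda>k. (1/2) ^ Suc k *\<^sub>R F (?A k))"
  proof (rule summable_comparison_test')
    show "summable (\<lambda>k. (1/2) ^ Suc k :: real)" using power_half_series by (rule sums_summable)
    fix k
    have "norm ((1/2) ^ Suc k *\<^sub>R F (?A k)) = (1/2) ^ Suc k * norm (F (?A k))" by simp
    also have "\<dots> \<le> (1/2) ^ Suc k * 1"
      by (intro mult_left_mono projection_norm_le_1 proj) simp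
    finally show "norm ((1/2) ^ Suc k *\<^sub>R F (?A k)) \<le> (1/2) ^ Suc k" by simp
  qed
  then obtain S where S: "(\<lambda>k. (1/2) ^ Suc k *\<^sub>R F (?A k)) sums S" by (auto simp: summable_def)
  have Sx: "(\<lambda>k. (1/2) ^ Suc k *\<^sub>R blinfun_apply (F (?A k)) g) sums blinfun_apply S g" for g
    using bounded_linear.sums[OF blinfun.bounded_linear_left S, of g]
    by (simp add: blinfun.scaleR_left)
  have Sin: "(\<lambda>k. (1/2) ^ Suc k * rinner (blinfun_apply (F (?A k)) g) h) sums rinner (blinfun_apply S g) h"
    for g h using sums_rinner_left[OF Sx, of g h] by (simp add: rinner_scaleR_left)
  have herm: "(\<Sum>k<n. (1/2) ^ Suc k *\<^sub>R F (?A k)) \<in> hermitian_operators" for n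
    using proj by (induction n)
      (auto intro!: hermitian_0 hermitian_add hermitian_scaleR simp: orthogonal_projections_iff)
  have "S \<in> hermitian_operators"
    using S unfolding sums_def
    by (intro hermitian_limit[OF herm] bounded_linear.tendsto[OF blinfun.bounded_linear_left])
  moreover have "rinner (blinfun_apply S g) g = (\<integral>x. f x \<partial>pvm_measure X F g)" for g
    using sums_unique2[OF Sin[of g g]]
      integral_binary_digit_sums_measure[OF finite_measure_pvm_measure borel_measurable_pvm_measure[OF meas],
        of g] f
    by (simp add: A_eq space_pvm_measure measure_pvm_measure[OF A] projection_norm_sq[OF proj])
  moreover have "(norm (blinfun_apply S g))\<^sup>2 = (\<integral>x. (f x)\<^sup>2 \<partial>pvm_measure X F g)" for g
  proof -
    let ?M = "pvm_measure X F g"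
    interpret finite_measure ?M by (rule finite_measure_pvm_measure)
    \<comment> \<open>Multiplicativity of \<open>F\<close> enters here: inner products of the
      vectors \<open>F (?A k) g\<close> become integrals of products of indicators.\<close>
    have ind: "rinner (blinfun_apply (F (?A k)) g) (blinfun_apply (F (?A j)) g) =
        (\<integral>x. indicator (?A k) x * indicator (?A j) x \<partial>?M)" for j k
    proof -
      have "rinner (blinfun_apply (F (?A k)) g) (blinfun_apply (F (?A j)) g) =
          rinner (blinfun_apply (F (?A j \<inter> ?A k)) g) g"
        using proj[of j] unfolding orthogonal_projections_iff
        by (simp add: pvmsD(4)[OF F A A] hermitianD)
      also have "\<dots> = measure ?M (?A j \<inter> ?A k)"
        unfolding measure_pvm_measure[OF sets.Int[OF A A]]
        by (rule projection_norm_sq[OF pvmsD(1)[OF F sets.Int[OF A A]]])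
      also have "\<dots> = (\<integral>x. indicator (?A j \<inter> ?A k) x \<partial>?M)"
        using sets.Int_space_eq2[of "?A j \<inter> ?A k" ?M] sets.Int[OF A A, of j k]
        by (simp add: sets_pvm_measure)
      finally show ?thesis by (simp add: indicator_inter_arith mult.commute)
    qed
    have meas': "f \<in> borel_measurable ?M" "(\<lambda>x. indicator (?A k) x :: real) \<in> borel_measurable ?M" for k
      using A[of k] by (intro borel_measurable_pvm_measure meas borel_measurable_indicator; simp)+
    \<comment> \<open>The squared norm of \<open>S g\<close> is a double digit series. Summing over
      \<open>j\<close> turns one indicator into \<open>f\<close>; the later sum over
      \<open>k\<close> turns the other one into \<open>f\<close> as well.\<close>
    have inner: "rinner (blinfun_apply (F (?A k)) g) (blinfun_apply S g) =
        (\<integral>x. indicator (?A k) x * f x \<partial>?M)" for k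
    proof (rule sums_unique2)
      show "(\<lambda>j. (1/2) ^ Suc j * (\<integral>x. indicator (?A j) x * indicator (?A k) x \<partial>?M)) sums
          rinner (blinfun_apply (F (?A k)) g) (blinfun_apply S g)"
        using Sin[of g "blinfun_apply (F (?A k)) g"]
        by (simp add: ind rinner_commute[of "blinfun_apply (F (?A k)) g" "blinfun_apply S g"])
      show "(\<lambda>j. (1/2) ^ Suc j * (\<integral>x. indicator (?A j) x * indicator (?A k) x \<partial>?M)) sums
          (\<integral>x. indicator (?A k) x * f x \<partial>?M)"
        using integral_binary_digit_sums[OF finite_measure_pvm_measure meas'(1) meas'(2)[of k], of 1] f
        by (simp add: A_eq space_pvm_measure mult.commute)
    qed
    have "(\<lambda>k. (1/2) ^ Suc k * (\<integral>x. indicator (?A k) x * f x \<partial>?M)) sums rinner (blinfun_apply S g) (blinfun_apply S g)"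
      using Sin[of g "blinfun_apply S g"] by (simp add: inner)
    moreover have "(\<lambda>k. (1/2) ^ Suc k * (\<integral>x. indicator (?A k) x * f x \<partial>?M)) sums (\<integral>x. f x * f x \<partial>?M)"
    proof -
      have "\<bar>f x\<bar> \<le> 1" if "x \<in> space ?M" for x
        using f that by (fastforce simp: space_pvm_measure)
      then show ?thesis
        using integral_binary_digit_sums[OF finite_measure_pvm_measure meas'(1) meas'(1), of 1] f
        by (simp add: A_eq space_pvm_measure)
    qed
    ultimately have "rinner (blinfun_apply S g) (blinfun_apply S g) = (\<integral>x. f x * f x \<partial>?M)"
      by (rule sums_unique2)
    then show ?thesis by (simp add: rinner_self power2_eq_square[of "f _"])
  qed
  ultimately show ?thesis by blast
qed

lemma spectral_integral_exists:
  fixes f :: "'x \<Rightarrow> real"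
  assumes meas: "f \<in> borel_measurable (borel_on X)" and B: "\<And>x. x \<in> X \<Longrightarrow> \<bar>f x\<bar> \<le> B"
  obtains S where "S \<in> hermitian_operators"
    "\<And>g. rinner (blinfun_apply S g) g = (\<integral>x. f x \<partial>pvm_measure X F g)"
    "\<And>g. (norm (blinfun_apply S g))\<^sup>2 = (\<integral>x. (f x)\<^sup>2 \<partial>pvm_measure X F g)"
proof -
  obtain u a b where u: "\<And>x. f x = a * u x + b" "\<And>x. u x = (f x - b) / a"
    "\<And>x. x \<in> X \<Longrightarrow> 0 \<le> u x" "\<And>x. x \<in> X \<Longrightarrow> u x < 1"
    using bounded_normalize[of X f B] B by metis
  have measu: "u \<in> borel_measurable (borel_on X)"
    unfolding u(2)[abs_def] using meas by measurable
  obtain T where T: "T \<in> hermitian_operators"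
    "\<And>g. rinner (blinfun_apply T g) g = (\<integral>x. u x \<partial>pvm_measure X F g)"
    "\<And>g. (norm (blinfun_apply T g))\<^sup>2 = (\<integral>x. (u x)\<^sup>2 \<partial>pvm_measure X F g)"
    using spectral_integral_exists_unit[OF measu u(3,4)] by blast
  define S where "S = a *\<^sub>R T + b *\<^sub>R id_blinfun"
  show ?thesis
  proof (rule that[of S])
    show "S \<in> hermitian_operators"
      unfolding S_def by (intro hermitian_add hermitian_scaleR hermitian_id T(1))
    fix g
    let ?M = "pvm_measure X F g"
    have M: "finite_measure ?M" by (rule finite_measure_pvm_measure)
    have measu': "u \<in> borel_measurable ?M" by (rule borel_measurable_pvm_measure[OF measu])
    have ub: "\<bar>u x\<bar> \<le> 1" if "x \<in> space ?M" for x
      using u(3,4) that by (fastforce simp: space_pvm_measure)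
    have int1: "integrable ?M u" by (rule integrable_bounded[OF M measu' ub])
    have int2: "integrable ?M (\<lambda>x. (u x)\<^sup>2)"
      using measu' ub by (intro integrable_bounded[OF M, of _ 1]) (auto simp: abs_square_le_1)
    have intc: "integrable ?M (\<lambda>x. c)" for c :: real
      by (intro integrable_bounded[OF M, of _ "\<bar>c\<bar>"]) auto
    have Sg: "blinfun_apply S g = a *\<^sub>R blinfun_apply T g + b *\<^sub>R g"
      by (simp add: S_def blinfun.add_left blinfun.scaleR_left)
    show "rinner (blinfun_apply S g) g = (\<integral>x. f x \<partial>?M)"
      unfolding Sg u(1) using int1 intc
      by (simp add: rinner_add_left rinner_scaleR_left rinner_self T(2) space_pvm_measure
          measure_pvm_measure_space)
    have "(norm (blinfun_apply S g))\<^sup>2 =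
        a\<^sup>2 * (norm (blinfun_apply T g))\<^sup>2 + 2 * a * b * rinner (blinfun_apply T g) g + b\<^sup>2 * (norm g)\<^sup>2"
      by (simp add: Sg norm_add_sq rinner_scaleR_left rinner_scaleR_right power_mult_distrib)
    also have "\<dots> = (\<integral>x. a\<^sup>2 * (u x)\<^sup>2 + 2 * a * b * u x + b\<^sup>2 \<partial>?M)"
      using int1 int2 intc by (simp add: T(2,3) space_pvm_measure measure_pvm_measure_space)
    also have "\<dots> = (\<integral>x. (f x)\<^sup>2 \<partial>?M)"
      unfolding u(1) by (simp add: power2_sum power_mult_distrib algebra_simps)
    finally show "(norm (blinfun_apply S g))\<^sup>2 = (\<integral>x. (f x)\<^sup>2 \<partial>?M)" .
  qed
qed

lemma rinner_pvm_polarization: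
  assumes A: "A \<in> sets (borel_on X)"
  shows "rinner (blinfun_apply (F A) g) h =
    measure (pvm_measure X F ((1/2) *\<^sub>R (g + h))) A - measure (pvm_measure X F ((1/2) *\<^sub>R (g - h))) A"
proof -
  have P: "F A \<in> orthogonal_projections" using A by (rule pvmsD(1)[OF F])
  then have "F A \<in> hermitian_operators" by (simp add: orthogonal_projections_iff)
  from hermitian_polarization[OF this, of g h] show ?thesis
    unfolding projection_norm_sq[OF P] measure_pvm_measure[OF A] .
qed

text \<open>By polarization the real part of \<open>F_{g,h}\<close> is a difference of scalar
  measures. The imaginary part is the real part at \<open>\<i> *\<^sub>C h\<close>, so the auxiliary
  fact, proved for every \<open>h\<close>, covers both.\<close>

lemma complex_measure_integral_pvm:
  fixes f :: "'x \<Rightarrow> real"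
  assumes meas: "f \<in> borel_measurable (borel_on X)" and B: "\<And>x. x \<in> X \<Longrightarrow> \<bar>f x\<bar> \<le> B"
    and S: "S \<in> hermitian_operators"
      "\<And>g. rinner (blinfun_apply S g) g = (\<integral>x. f x \<partial>pvm_measure X F g)"
  shows "complex_measure_integral (borel_on X) (\<lambda>A. cinner (blinfun_apply (F A) g) h)
      (\<lambda>x. complex_of_real (f x)) = cinner (blinfun_apply S g) h"
proof -
  have *: "signed_measure_integral (borel_on X) (\<lambda>A. rinner (blinfun_apply (F A) g) h)
      (\<lambda>x. complex_of_real (f x)) = complex_of_real (rinner (blinfun_apply S g) h)" for h
    unfolding hermitian_polarization[OF S(1), of g h] S(2)
    using meas B
    by (intro signed_measure_integral_diff[where B = B] finite_measure_pvm_measure sets_pvm_measure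
        rinner_pvm_polarization) (auto simp: space_restrict_space)
  show ?thesis
    unfolding complex_measure_integral_def Im_cinner rinner_def[symmetric] *
    by (rule complex_eqI) (simp_all add: Im_cinner, simp add: rinner_def)
qed

text \<open>Resolves the description: the digit series gives existence, and an operator is
  determined by its inner products. Everything later uses only these three facts. The third encodes
  that the integral of \<open>f\<close> squares to the integral of its square.\<close>

lemma pvm_integral_works:
  fixes f :: "'x \<Rightarrow> real"
  assumes meas: "f \<in> borel_measurable (borel_on X)" and B: "\<And>x. x \<in> X \<Longrightarrow> \<bar>f x\<bar> \<le> B"
  shows "pvm_integral X F (\<lambda>x. complex_of_real (f x)) \<in> hermitian_operators"
    and "rinner (blinfun_apply (pvm_integral X F (\<lambda>x. complex_of_real (f x))) g) g =
      (\<integral>x. f x \<partial>pvm_measure X F g)"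
    and "(norm (blinfun_apply (pvm_integral X F (\<lambda>x. complex_of_real (f x))) g))\<^sup>2 =
      (\<integral>x. (f x)\<^sup>2 \<partial>pvm_measure X F g)"
proof -
  obtain S where S: "S \<in> hermitian_operators"
    "\<And>g. rinner (blinfun_apply S g) g = (\<integral>x. f x \<partial>pvm_measure X F g)"
    "\<And>g. (norm (blinfun_apply S g))\<^sup>2 = (\<integral>x. (f x)\<^sup>2 \<partial>pvm_measure X F g)"
    using spectral_integral_exists[OF meas B] by blast
  have "pvm_integral X F (\<lambda>x. complex_of_real (f x)) = S"
    unfolding pvm_integral_def
  proof (rule the_equality, goal_cases)
    case 1
    show ?case
      using hermitian_bounded[OF S(1)] by (simp add: complex_measure_integral_pvm[OF meas B S(1,2)])
  next
    case (2 T)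
    then have "cinner (blinfun_apply T g) h = cinner (blinfun_apply S g) h" for g h
      by (simp add: complex_measure_integral_pvm[OF meas B S(1,2)])
    then show ?case by (intro blinfun_eqI rinner_eqI) (simp add: rinner_def)
  qed
  then show "pvm_integral X F (\<lambda>x. complex_of_real (f x)) \<in> hermitian_operators"
    "rinner (blinfun_apply (pvm_integral X F (\<lambda>x. complex_of_real (f x))) g) g =
      (\<integral>x. f x \<partial>pvm_measure X F g)"
    "(norm (blinfun_apply (pvm_integral X F (\<lambda>x. complex_of_real (f x))) g))\<^sup>2 =
      (\<integral>x. (f x)\<^sup>2 \<partial>pvm_measure X F g)"
    using S by simp_all
qed

end

section \<open>The metric and its completeness\<close>

abbreviation real_integral ::
    "'x::topological_space set \<Rightarrow> ('x set \<Rightarrow> 'h::complex_hilbert_space \<Rightarrow>\<^sub>L 'h) \<Rightarrow> ('x \<Rightarrow> real) \<Rightarrow> 'h \<Rightarrow>\<^sub>L 'h"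
  where "real_integral X F f \<equiv> pvm_integral X F (\<lambda>x. complex_of_real (f x))"

lemma bump_mono: "k \<le> j \<Longrightarrow> bump X U k x \<le> bump X U j x"
proof -
  assume "k \<le> j"
  then have "real k * infdist x (X - U) \<le> real j * infdist x (X - U)"
    by (intro mult_right_mono infdist_nonneg) simp
  then show ?thesis unfolding bump_def by (auto simp: min_def)
qed

text \<open>Both limits are dominated convergence towards an indicator, which equals its own square.
  That the two limits coincide is what later makes the strong limit of bump integrals
  idempotent.\<close>

lemma integral_bump_tendsto:
  assumes M: "finite_measure M" "sets M = sets (borel_on X)" and U: "openin (top_of_set X) U"
  shows "(\<lambda>k. \<integral>x. bump X U k x \<partial>M) \<longlonglongrightarrow> measure M U"
    and "(\<lambda>k. \<integral>x. (bump X U k x)\<^sup>2 \<partial>M) \<longlonglongrightarrow> measure M U"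
proof -
  interpret finite_measure M by fact
  have sp: "space M = X" using sets_eq_imp_space_eq[OF M(2)] by (simp add: space_restrict_space)
  have U': "U \<in> sets M" using openin_in_sets_borel_on[OF U] M(2) by simp
  have meas: "bump X U k \<in> borel_measurable M" for k
    using borel_measurable_is_lipschitz_on[OF is_lipschitz_on_bump] M(2)
    by (simp cong: measurable_cong_sets)
  have ind: "(\<integral>x. indicator U x \<partial>M) = measure M U"
    using U' by (simp add: sets.Int_space_eq2)
  have "(\<lambda>k. \<integral>x. bump X U k x \<partial>M) \<longlonglongrightarrow> (\<integral>x. indicator U x \<partial>M)"
    using U' meas bump_tendsto_indicator[OF U]
    by (intro integral_dominated_convergence[where w = "\<lambda>_. 1"])
      (auto simp: sp bump_nonneg bump_le_1 intro!: AE_I2)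
  then show "(\<lambda>k. \<integral>x. bump X U k x \<partial>M) \<longlonglongrightarrow> measure M U" by (simp only: ind)
  have "(\<lambda>k. (bump X U k x)\<^sup>2) \<longlonglongrightarrow> indicator U x" if "x \<in> X" for x
  proof -
    have "(indicator U x :: real)\<^sup>2 = indicator U x" by (simp add: indicator_def)
    then show ?thesis
      using tendsto_power[OF bump_tendsto_indicator[OF U that], of 2] by (simp only:)
  qed
  then have "(\<lambda>k. \<integral>x. (bump X U k x)\<^sup>2 \<partial>M) \<longlonglongrightarrow> (\<integral>x. indicator U x \<partial>M)"
    using U' meas
    by (intro integral_dominated_convergence[where w = "\<lambda>_. 1"])
      (auto simp: sp bump_nonneg bump_le_1 power_le_one intro!: AE_I2)
  then show "(\<lambda>k. \<integral>x. (bump X U k x)\<^sup>2 \<partial>M) \<longlonglongrightarrow> measure M U" by (simp only: ind)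
qed

text \<open>Bumps recover the masses of relatively open sets, and these form an intersection-stable
  generator.\<close>

lemma measure_eqI_lipschitz:
  assumes X: "compact X" and M: "finite_measure M" "sets M = sets (borel_on X)"
    and N: "finite_measure N" "sets N = sets (borel_on X)"
    and eq: "\<And>f. is_lipschitz_on X f \<Longrightarrow> (\<integral>x. f x \<partial>M) = (\<integral>x. f x \<partial>N)"
  shows "M = N"
proof (rule measure_eqI_generator_eq[where \<Omega> = X and E = "{U. openin (top_of_set X) U}"
      and A = "\<lambda>_. X"])
  fix U assume "U \<in> {U. openin (top_of_set X) U}"
  then have U: "openin (top_of_set X) U" by simp
  have "measure M U = measure N U"
    using integral_bump_tendsto(1)[OF M U] integral_bump_tendsto(1)[OF N U]
    unfolding eq[OF is_lipschitz_on_bump] by (rule LIMSEQ_unique)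
  then show "emeasure M U = emeasure N U"
    by (simp add: finite_measure.emeasure_eq_measure M(1) N(1))
qed (use M N in \<open>auto simp: Int_stable_openin sets_borel_on[OF compact_imp_closed[OF X]]
    finite_measure.emeasure_finite dest: openin_imp_subset\<close>)

context
  fixes X :: "'x::metric_space set"
  assumes X: "compact X"
begin

lemma real_integral_works:
  fixes F :: "'x set \<Rightarrow> 'h::complex_hilbert_space \<Rightarrow>\<^sub>L 'h"
  assumes F: "F \<in> pvms X" and f: "is_lipschitz_on X f"
  shows real_integral_hermitian: "real_integral X F f \<in> hermitian_operators"
    and rinner_real_integral:
      "rinner (blinfun_apply (real_integral X F f) g) g = (\<integral>x. f x \<partial>pvm_measure X F g)"
    and norm_sq_real_integral:
      "(norm (blinfun_apply (real_integral X F f) g))\<^sup>2 = (\<integral>x. (f x)\<^sup>2 \<partial>pvm_measure X F g)"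
proof -
  obtain B where B: "\<And>x. x \<in> X \<Longrightarrow> \<bar>f x\<bar> \<le> B" using is_lipschitz_on_bounded[OF X f] by blast
  note * = pvm_integral_works[OF F borel_measurable_is_lipschitz_on[OF f] B]
  show "real_integral X F f \<in> hermitian_operators"
    "rinner (blinfun_apply (real_integral X F f) g) g = (\<integral>x. f x \<partial>pvm_measure X F g)"
    "(norm (blinfun_apply (real_integral X F f) g))\<^sup>2 = (\<integral>x. (f x)\<^sup>2 \<partial>pvm_measure X F g)"
    by (rule *; assumption)+
qed

lemma integrable_pvm_measure:
  assumes F: "F \<in> pvms X" and f: "is_lipschitz_on X f"
  shows "integrable (pvm_measure X F g) f"
proof -
  obtain B where B: "\<And>x. x \<in> X \<Longrightarrow> \<bar>f x\<bar> \<le> B" using is_lipschitz_on_bounded[OF X f] by blast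
  show ?thesis
    by (rule integrable_bounded[OF finite_measure_pvm_measure[OF F]
          borel_measurable_pvm_measure[OF F borel_measurable_is_lipschitz_on[OF f]], of _ B])
      (simp add: space_pvm_measure B)
qed

lemma real_integral_eqI:
  fixes F :: "'x set \<Rightarrow> 'h::complex_hilbert_space \<Rightarrow>\<^sub>L 'h"
  assumes "F \<in> pvms X" "is_lipschitz_on X f" "S \<in> hermitian_operators"
    and "\<And>g. rinner (blinfun_apply S g) g = (\<integral>x. f x \<partial>pvm_measure X F g)"
  shows "real_integral X F f = S"
  by (rule hermitian_eqI) (simp_all add: assms real_integral_works)

lemma real_integral_add:
  assumes F: "F \<in> pvms X" and f: "is_lipschitz_on X f" "is_lipschitz_on X h"
  shows "real_integral X F (\<lambda>x. f x + h x) = real_integral X F f + real_integral X F h"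
  by (intro real_integral_eqI F is_lipschitz_on_add f hermitian_add real_integral_hermitian)
    (simp add: blinfun.add_left rinner_add_left rinner_real_integral F f integrable_pvm_measure)

lemma real_integral_cmult:
  assumes F: "F \<in> pvms X" and f: "is_lipschitz_on X f"
  shows "real_integral X F (\<lambda>x. c * f x) = c *\<^sub>R real_integral X F f"
  by (intro real_integral_eqI F is_lipschitz_on_cmult f hermitian_scaleR real_integral_hermitian)
    (simp add: blinfun.scaleR_left rinner_scaleR_left rinner_real_integral F f)

lemma real_integral_const:
  assumes F: "F \<in> pvms X"
  shows "real_integral X F (\<lambda>_. c) = c *\<^sub>R id_blinfun"
  by (intro real_integral_eqI F is_lipschitz_on_const hermitian_scaleR hermitian_id)
    (simp add: blinfun.scaleR_left rinner_scaleR_left rinner_self space_pvm_measure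
      measure_pvm_measure_space[OF F])

text \<open>The squared norm at \<open>g\<close> is the integral of the square of \<open>f\<close>,
  and the total mass is the squared norm of \<open>g\<close>.\<close>

lemma norm_real_integral_le:
  fixes F :: "'x set \<Rightarrow> 'h::complex_hilbert_space \<Rightarrow>\<^sub>L 'h"
  assumes F: "F \<in> pvms X" and f: "is_lipschitz_on X f" and B: "0 \<le> B" "\<And>x. x \<in> X \<Longrightarrow> \<bar>f x\<bar> \<le> B"
  shows "norm (real_integral X F f) \<le> B"
proof (rule norm_blinfun_bound[OF B(1)])
  fix g :: 'h
  interpret finite_measure "pvm_measure X F g" by (rule finite_measure_pvm_measure[OF F])
  have "(norm (blinfun_apply (real_integral X F f) g))\<^sup>2 = (\<integral>x. f x * f x \<partial>pvm_measure X F g)"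
    by (simp add: norm_sq_real_integral F f power2_eq_square[of "f _"])
  also have "\<dots> \<le> (\<integral>x. B\<^sup>2 \<partial>pvm_measure X F g)"
  proof (rule integral_mono)
    show "integrable (pvm_measure X F g) (\<lambda>x. f x * f x)"
      by (intro integrable_pvm_measure F is_lipschitz_on_mult X f)
    show "f x * f x \<le> B\<^sup>2" if "x \<in> space (pvm_measure X F g)" for x
      using power_mono[OF B(2), of x 2] that by (simp add: space_pvm_measure power2_eq_square)
  qed simp
  also have "\<dots> = (B * norm g)\<^sup>2"
    by (simp add: space_pvm_measure measure_pvm_measure_space[OF F] power_mult_distrib mult.commute)
  finally show "norm (blinfun_apply (real_integral X F f) g) \<le> B * norm g"
    using B(1) by (simp add: power2_le_iff_abs_le)
qed

lemma pvm_eqI: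
  fixes E F :: "'x set \<Rightarrow> 'h::complex_hilbert_space \<Rightarrow>\<^sub>L 'h"
  assumes E: "E \<in> pvms X" and F: "F \<in> pvms X"
    and eq: "\<And>f. is_lipschitz_on X f \<Longrightarrow> real_integral X E f = real_integral X F f"
  shows "E = F"
proof (rule PiE_ext)
  show "E \<in> sets (borel_on X) \<rightarrow>\<^sub>E orthogonal_projections" using E by (simp add: pvms_def)
  show "F \<in> sets (borel_on X) \<rightarrow>\<^sub>E orthogonal_projections" using F by (simp add: pvms_def)
  have M: "pvm_measure X E g = pvm_measure X F g" for g
    using rinner_real_integral[OF E] rinner_real_integral[OF F] eq
    by (intro measure_eqI_lipschitz[OF X] finite_measure_pvm_measure sets_pvm_measure E F) metis
  fix A assume A: "A \<in> sets (borel_on X)"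
  have P: "E A \<in> orthogonal_projections" "F A \<in> orthogonal_projections"
    using A E F by (auto intro: pvmsD(1))
  show "E A = F A"
  proof (rule hermitian_eqI)
    show "rinner (blinfun_apply (E A) g) g = rinner (blinfun_apply (F A) g) g" for g
      unfolding P[THEN projection_norm_sq] measure_pvm_measure[OF E A, symmetric]
        measure_pvm_measure[OF F A, symmetric] M ..
  qed (use P in \<open>simp_all add: orthogonal_projections_iff\<close>)
qed

text \<open>A real \<open>SUP\<close> bounds its members only when the family is bounded above, and
  \<open>1\<close>-Lipschitz functions are not uniformly bounded. Constants, however, integrate to
  the same multiple of the identity under \<open>E\<close> and \<open>F\<close> and cancel in the
  difference; after subtracting one, a \<open>1\<close>-Lipschitz function is bounded by the
  diameter bound \<open>D\<close>.\<close>

lemma norm_real_integral_diff_le_pvm_dist: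
  fixes E F :: "'x set \<Rightarrow> 'h::complex_hilbert_space \<Rightarrow>\<^sub>L 'h"
  assumes E: "E \<in> pvms X" and F: "F \<in> pvms X" and f: "1-lipschitz_on X f"
  shows "norm (real_integral X E f - real_integral X F f) \<le> pvm_dist X E F"
proof -
  obtain D where D: "0 \<le> D" "\<And>x y. x \<in> X \<Longrightarrow> y \<in> X \<Longrightarrow> dist x y \<le> D"
  proof -
    obtain D where "\<And>x y. x \<in> X \<Longrightarrow> y \<in> X \<Longrightarrow> dist x y \<le> D"
      using compact_imp_bounded[OF X] unfolding bounded_two_points by blast
    then show ?thesis using that[of "max 0 D"] by (simp add: le_max_iff_disj)
  qed
  have "norm (real_integral X E h - real_integral X F h) \<le> D + D" if h: "1-lipschitz_on X h" for h
  proof -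
    \<comment> \<open>\<open>c\<close> is the value at a base point; for empty \<open>X\<close> any
      number will do.\<close>
    obtain c where c: "\<And>x. x \<in> X \<Longrightarrow> \<bar>h x - c\<bar> \<le> D"
    proof (cases "X = {}")
      case False
      then obtain y where y: "y \<in> X" by blast
      have "\<bar>h x - h y\<bar> \<le> D" if "x \<in> X" for x
        using lipschitz_onD[OF h that y] D(2)[OF that y] by (simp add: dist_real_def)
      then show ?thesis using that by blast
    qed simp
    define u where "u = (\<lambda>x. h x - c)"
    have u: "is_lipschitz_on X u"
      unfolding u_def by (intro is_lipschitz_on_diff is_lipschitz_onI[OF h] is_lipschitz_on_const)
    have "real_integral X G h = real_integral X G u + c *\<^sub>R id_blinfun" if "G \<in> pvms X" for G :: "'x set \<Rightarrow> 'h \<Rightarrow>\<^sub>L 'h"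
      using real_integral_add[OF that u is_lipschitz_on_const[of X c]] real_integral_const[OF that]
      by (simp add: u_def)
    then have "norm (real_integral X E h - real_integral X F h) =
        norm (real_integral X E u - real_integral X F u)"
      using E F by simp
    also have "\<dots> \<le> norm (real_integral X E u) + norm (real_integral X F u)"
      by (rule norm_triangle_ineq4)
    also have "\<dots> \<le> D + D"
      using c by (intro add_mono norm_real_integral_le E F u D(1)) (auto simp: u_def)
    finally show ?thesis .
  qed
  then have "bdd_above ((\<lambda>f. norm (real_integral X E f - real_integral X F f)) ` {f. 1-lipschitz_on X f})"
    by (auto intro!: bdd_aboveI)
  then show ?thesis
    unfolding pvm_dist_def using E F f by (auto intro!: cSUP_upper)
qed

lemma pvm_dist_le:
  fixes E F :: "'x set \<Rightarrow> 'h::complex_hilbert_space \<Rightarrow>\<^sub>L 'h"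
  assumes "E \<in> pvms X" "F \<in> pvms X"
    and "\<And>f. 1-lipschitz_on X f \<Longrightarrow> norm (real_integral X E f - real_integral X F f) \<le> c"
  shows "pvm_dist X E F \<le> c"
proof -
  have "{f :: 'x \<Rightarrow> real. 1-lipschitz_on X f} \<noteq> {}"
    using lipschitz_on_le[OF lipschitz_on_constant[of X "0 :: real"], of 1] by auto
  then show ?thesis
    unfolding pvm_dist_def using assms by (auto intro!: cSUP_least)
qed

text \<open>Rescaling to Lipschitz constant 1. The divisor is \<open>C + 1\<close> because
  \<open>C\<close> may be 0.\<close>

lemma norm_real_integral_diff_le:
  fixes E F :: "'x set \<Rightarrow> 'h::complex_hilbert_space \<Rightarrow>\<^sub>L 'h"
  assumes E: "E \<in> pvms X" and F: "F \<in> pvms X" and f: "C-lipschitz_on X f"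
  shows "norm (real_integral X E f - real_integral X F f) \<le> (C + 1) * pvm_dist X E F"
proof -
  define K where "K = C + 1"
  have C: "0 \<le> C" using lipschitz_on_nonneg[OF f] .
  then have K: "K > 0" by (simp add: K_def)
  define h where "h = (\<lambda>x. (1 / K) * f x)"
  have "1-lipschitz_on X h"
    unfolding h_def
    by (rule lipschitz_on_le[OF lipschitz_on_cmult_real[OF f]]) (use C in \<open>simp add: K_def\<close>)
  then have *: "norm (real_integral X E h - real_integral X F h) \<le> pvm_dist X E F"
    by (rule norm_real_integral_diff_le_pvm_dist[OF E F])
  have h: "is_lipschitz_on X h" unfolding h_def by (intro is_lipschitz_on_cmult is_lipschitz_onI[OF f])
  have "f = (\<lambda>x. K * h x)" using K by (simp add: h_def)
  then have "real_integral X E f - real_integral X F f = K *\<^sub>R (real_integral X E h - real_integral X F h)"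
    using real_integral_cmult[OF E h, of K] real_integral_cmult[OF F h, of K]
    by (simp add: scaleR_diff_right)
  then show ?thesis using * K by (simp add: K_def[symmetric])
qed

theorem Metric_space_pvms:
  "Metric_space (pvms X :: ('x set \<Rightarrow> 'h::complex_hilbert_space \<Rightarrow>\<^sub>L 'h) set) (pvm_dist X)"
proof
  fix E F G :: "'x set \<Rightarrow> 'h \<Rightarrow>\<^sub>L 'h"
  show "0 \<le> pvm_dist X E F"
  proof (cases "E \<in> pvms X \<and> F \<in> pvms X")
    case True
    have "1-lipschitz_on X (\<lambda>_. 0 :: real)"
      by (rule lipschitz_on_le[OF lipschitz_on_constant]) simp
    from norm_real_integral_diff_le_pvm_dist[OF _ _ this, of E F] show ?thesis
      using True norm_ge_zero order_trans by blast
  qed (auto simp: pvm_dist_def)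
  show "pvm_dist X E F = pvm_dist X F E"
    by (auto simp: pvm_dist_def norm_minus_commute)
  show "pvm_dist X E F = 0 \<longleftrightarrow> E = F" if EF: "E \<in> pvms X" "F \<in> pvms X"
  proof
    \<comment> \<open>The distance controls every Lipschitz function after rescaling, so distance 0
      gives equal integrals, hence equal scalar measures and equal projections.\<close>
    assume 0: "pvm_dist X E F = 0"
    show "E = F"
    proof (rule pvm_eqI[OF EF])
      fix f assume "is_lipschitz_on X f"
      then obtain C where "C-lipschitz_on X f" by (auto simp: is_lipschitz_on_def)
      from norm_real_integral_diff_le[OF EF this] 0
      show "real_integral X E f = real_integral X F f" by simp
    qed
  next
    assume "E = F"
    then have "pvm_dist X E F \<le> 0" using EF by (intro pvm_dist_le) auto
    then show "pvm_dist X E F = 0" using \<open>0 \<le> pvm_dist X E F\<close> by simp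
  qed
  show "pvm_dist X E G \<le> pvm_dist X E F + pvm_dist X F G"
    if EFG: "E \<in> pvms X" "F \<in> pvms X" "G \<in> pvms X"
  proof (rule pvm_dist_le[OF EFG(1,3)])
    fix f :: "'x \<Rightarrow> real" assume f: "1-lipschitz_on X f"
    have "norm (real_integral X E f - real_integral X G f) \<le>
        norm (real_integral X E f - real_integral X F f) + norm (real_integral X F f - real_integral X G f)"
      by (rule norm_diff_triangle_ineq[of _ "real_integral X F f" "real_integral X F f", simplified])
    also have "\<dots> \<le> pvm_dist X E F + pvm_dist X F G"
      by (intro add_mono norm_real_integral_diff_le_pvm_dist EFG f)
    finally show "norm (real_integral X E f - real_integral X G f) \<le> pvm_dist X E F + pvm_dist X F G" .
  qed
qed

end

section \<open>Orthogonal sums and strong limits of projections\<close>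

lemma projection_diff_id:
  assumes "P \<in> orthogonal_projections"
  shows "id_blinfun - P \<in> orthogonal_projections"
proof -
  have "blinfun_apply P (blinfun_apply P x) = blinfun_apply P x" for x
    using assms unfolding orthogonal_projections_iff by (metis blinfun_apply_blinfun_compose)
  then show ?thesis
    using assms unfolding orthogonal_projections_iff
    by (auto intro!: hermitian_diff hermitian_id blinfun_eqI simp: blinfun.diff_left blinfun.diff_right)
qed

lemma projection_orthogonal_sum:
  assumes fin: "finite I" and P: "\<And>i. i \<in> I \<Longrightarrow> P i \<in> orthogonal_projections"
    and orth: "\<And>i j. i \<in> I \<Longrightarrow> j \<in> I \<Longrightarrow> i \<noteq> j \<Longrightarrow> P i o\<^sub>L P j = 0"
  shows "(norm (\<Sum>i\<in>I. blinfun_apply (P i) g))\<^sup>2 = (\<Sum>i\<in>I. (norm (blinfun_apply (P i) g))\<^sup>2)"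
  using fin P orth
proof (induction I)
  case (insert i I)
  have "rinner (blinfun_apply (P i) g) (\<Sum>j\<in>I. blinfun_apply (P j) g) =
      (\<Sum>j\<in>I. rinner (blinfun_apply (P i) g) (blinfun_apply (P j) g))"
    by (rule bounded_bilinear.sum_right[OF bounded_bilinear_rinner])
  also have "\<dots> = 0"
  proof (rule sum.neutral, rule ballI)
    fix j assume j: "j \<in> I"
    have "rinner (blinfun_apply (P i) g) (blinfun_apply (P j) g) =
        rinner g (blinfun_apply (P i o\<^sub>L P j) g)"
      using insert.prems(1)[of i] by (simp add: orthogonal_projections_iff hermitianD)
    moreover have "P i o\<^sub>L P j = 0" using insert.prems(2)[of i j] insert.hyps j by auto
    ultimately show "rinner (blinfun_apply (P i) g) (blinfun_apply (P j) g) = 0"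
      by (simp only: zero_blinfun.rep_eq rinner_zero_right)
  qed
  finally show ?case using insert by (simp add: norm_add_sq)
qed simp

text \<open>The assumption \<open>diff\<close> holds for \<open>T n\<close> increasing with \<open>0 \<le> T k - T n \<le> 1\<close>, as
  \<open>S\<^sup>2 \<le> S\<close> for \<open>0 \<le> S \<le> 1\<close>.\<close>

lemma projection_strong_limit:
  fixes T :: "nat \<Rightarrow> 'h::complex_hilbert_space \<Rightarrow>\<^sub>L 'h"
  assumes T: "\<And>n. T n \<in> hermitian_operators"
    and bound: "\<And>n g. norm (blinfun_apply (T n) g) \<le> norm g"
    and diff: "\<And>n k g. n \<le> k \<Longrightarrow> (norm (blinfun_apply (T k) g - blinfun_apply (T n) g))\<^sup>2 \<le>
      rinner (blinfun_apply (T k) g) g - rinner (blinfun_apply (T n) g) g"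
    and lim: "\<And>g. (\<lambda>n. rinner (blinfun_apply (T n) g) g) \<longlonglongrightarrow> m g"
    and lim_sq: "\<And>g. (\<lambda>n. (norm (blinfun_apply (T n) g))\<^sup>2) \<longlonglongrightarrow> m g"
  shows "\<exists>P\<in>orthogonal_projections. \<forall>g. (norm (blinfun_apply P g))\<^sup>2 = m g"
proof -
  have "Cauchy (\<lambda>n. blinfun_apply (T n) g)" for g
  proof (rule metric_CauchyI)
    fix e :: real assume e: "0 < e"
    \<comment> \<open>Convergence of the scalar forms is upgraded to Cauchyness of the vectors by
      \<open>diff\<close>, which bounds a squared norm; hence the threshold
      \<open>e\<^sup>2\<close>.\<close>
    obtain N where N: "\<And>k n. N \<le> k \<Longrightarrow> N \<le> n \<Longrightarrow>
        dist (rinner (blinfun_apply (T k) g) g) (rinner (blinfun_apply (T n) g) g) < e\<^sup>2"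
      using metric_CauchyD[OF LIMSEQ_imp_Cauchy[OF lim], of "e\<^sup>2" g] e by auto
    have *: "norm (blinfun_apply (T k) g - blinfun_apply (T n) g) < e" if "N \<le> n" "n \<le> k" for n k
    proof -
      have "(norm (blinfun_apply (T k) g - blinfun_apply (T n) g))\<^sup>2 < e\<^sup>2"
        using diff[OF that(2), of g] N[of k n] that by (auto simp: dist_real_def)
      then show ?thesis using e power_less_imp_less_base by fastforce
    qed
    have "dist (blinfun_apply (T k) g) (blinfun_apply (T n) g) < e" if "N \<le> k" "N \<le> n" for k n
      using *[of n k] *[of k n] that
      by (cases "n \<le> k") (auto simp: dist_norm norm_minus_commute)
    then show "\<exists>N. \<forall>k\<ge>N. \<forall>n\<ge>N. dist (blinfun_apply (T k) g) (blinfun_apply (T n) g) < e" by blast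
  qed
  then obtain p where p: "\<And>g. (\<lambda>n. blinfun_apply (T n) g) \<longlonglongrightarrow> p g"
    unfolding Cauchy_convergent_iff convergent_def by metis
  have "bounded_linear p"
  proof (rule bounded_linear_intro[of _ 1])
    fix x y :: 'h and r :: real
    show "p (x + y) = p x + p y"
      using p[of "x + y"] tendsto_add[OF p[of x] p[of y]]
      by (auto simp: blinfun.add_right intro: LIMSEQ_unique)
    show "p (r *\<^sub>R x) = r *\<^sub>R p x"
      using p[of "r *\<^sub>R x"] tendsto_scaleR[OF tendsto_const p[of x], of r]
      by (auto simp: blinfun.scaleR_right intro: LIMSEQ_unique)
    show "norm (p x) \<le> norm x * 1"
      using tendsto_norm[OF p[of x]] bound by (auto intro: LIMSEQ_le_const2)
  qed
  then obtain P where P: "\<And>g. blinfun_apply P g = p g"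
    using bounded_linear_Blinfun_apply by metis
  have lim': "(\<lambda>n. blinfun_apply (T n) g) \<longlonglongrightarrow> blinfun_apply P g" for g
    using p P by simp
  have herm: "P \<in> hermitian_operators" by (rule hermitian_limit[OF T lim'])
  have q: "rinner (blinfun_apply P g) g = m g" for g
    by (rule LIMSEQ_unique[OF tendsto_rinner[OF lim' tendsto_const] lim])
  have n: "(norm (blinfun_apply P g))\<^sup>2 = m g" for g
    by (rule LIMSEQ_unique[OF tendsto_power[OF tendsto_norm[OF lim']] lim_sq])
  \<comment> \<open>The form of \<open>P o\<^sub>L P\<close> at \<open>g\<close> is the squared norm
    of \<open>P g\<close>. It equals the form of \<open>P\<close> because \<open>lim\<close> and
    \<open>lim_sq\<close> have the same limit.\<close>
  have "P o\<^sub>L P = P"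
  proof (rule hermitian_eqI)
    show "P o\<^sub>L P \<in> hermitian_operators"
      using herm by (simp add: hermitian_operators_def bounded_operators_def)
    show "rinner (blinfun_apply (P o\<^sub>L P) g) g = rinner (blinfun_apply P g) g" for g
      using hermitianD[OF herm, of "blinfun_apply P g" g] by (simp add: rinner_self n q)
  qed (rule herm)
  then have "P \<in> orthogonal_projections" using herm by (simp add: orthogonal_projections_iff)
  then show ?thesis using n by blast
qed

section \<open>From a limiting calculus on Lipschitz functions to projections for all Borel
  sets\<close>

text \<open>These are the properties of spectral integrals that survive norm limits.
  Multiplicativity is kept only as \<open>norm_sq\<close>, the quadratic form of the identity for
  squares.\<close>

locale lipschitz_calculus =
  fixes X :: "'x::metric_space set" and T :: "('x \<Rightarrow> real) \<Rightarrow> 'h::complex_hilbert_space \<Rightarrow>\<^sub>L 'h"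
  assumes compact: "compact X"
    and hermitian: "is_lipschitz_on X f \<Longrightarrow> T f \<in> hermitian_operators"
    and add: "is_lipschitz_on X f \<Longrightarrow> is_lipschitz_on X h \<Longrightarrow> T (\<lambda>x. f x + h x) = T f + T h"
    and cmult: "is_lipschitz_on X f \<Longrightarrow> T (\<lambda>x. c * f x) = c *\<^sub>R T f"
    and one: "T (\<lambda>_. 1) = id_blinfun"
    and nonneg: "is_lipschitz_on X f \<Longrightarrow> (\<And>x. x \<in> X \<Longrightarrow> 0 \<le> f x) \<Longrightarrow> 0 \<le> rinner (blinfun_apply (T f) g) g"
    and norm_sq: "is_lipschitz_on X f \<Longrightarrow>
      (norm (blinfun_apply (T f) g))\<^sup>2 = rinner (blinfun_apply (T (\<lambda>x. (f x)\<^sup>2)) g) g"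
begin

sublocale form: positive_lipschitz_functional X "\<lambda>f. rinner (blinfun_apply (T f) g) g" for g
  by unfold_locales
    (simp_all add: compact add cmult nonneg blinfun.add_left blinfun.scaleR_left rinner_add_left
      rinner_scaleR_left)

definition scalar_measure :: "'h \<Rightarrow> 'x measure"
  where "scalar_measure g = form.rep_measure g"

lemma sets_scalar_measure: "sets (scalar_measure g) = sets (borel_on X)"
  by (simp add: scalar_measure_def form.sets_rep_measure)

lemma space_scalar_measure: "space (scalar_measure g) = X"
  by (simp add: scalar_measure_def form.space_rep_measure)

lemma finite_scalar_measure: "finite_measure (scalar_measure g)"
  by (simp add: scalar_measure_def form.finite_measure_rep_measure)

lemma form_eq: "is_lipschitz_on X f \<Longrightarrow> rinner (blinfun_apply (T f) g) g = (\<integral>x. f x \<partial>scalar_measure g)"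
  by (simp add: scalar_measure_def form.integral_rep_measure)

lemma measure_scalar_measure_space: "measure (scalar_measure g) X = (norm g)\<^sup>2"
  using form_eq[OF is_lipschitz_on_const[of X 1]] by (simp add: one rinner_self space_scalar_measure)

lemma measure_scalar_measure_le: "measure (scalar_measure g) A \<le> (norm g)\<^sup>2"
  using finite_measure.bounded_measure[OF finite_scalar_measure, of g A]
  by (simp add: space_scalar_measure measure_scalar_measure_space)

lemma is_lipschitz_on_power2: "is_lipschitz_on X f \<Longrightarrow> is_lipschitz_on X (\<lambda>x. (f x)\<^sup>2)"
  using is_lipschitz_on_mult[OF compact, of f f] by (simp add: power2_eq_square)

definition represents :: "'x set \<Rightarrow> ('h \<Rightarrow>\<^sub>L 'h) \<Rightarrow> bool"
  where "represents A P \<longleftrightarrow> P \<in> orthogonal_projections \<and>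
    (\<forall>g. (norm (blinfun_apply P g))\<^sup>2 = measure (scalar_measure g) A)"

text \<open>The differences \<open>?d\<close> of bumps take values in \<open>[0, 1]\<close>, so
  their squares lie below them. By \<open>norm_sq\<close> and positivity this is precisely the
  estimate from which \<open>projection_strong_limit\<close> draws strong convergence.\<close>

lemma represents_openin:
  assumes U: "openin (top_of_set X) U"
  shows "\<exists>P. represents U P"
proof -
  let ?b = "bump X U"
  have lip: "is_lipschitz_on X (?b k)" for k by (rule is_lipschitz_on_bump)
  have bound: "\<bar>?b k x\<bar> \<le> 1" for k x using bump_nonneg[of X U k x] bump_le_1[of X U k x] by simp
  have *: "(norm (blinfun_apply (T (?b k)) g - blinfun_apply (T (?b n)) g))\<^sup>2 \<le>
      rinner (blinfun_apply (T (?b k)) g) g - rinner (blinfun_apply (T (?b n)) g) g"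
    if nk: "n \<le> k" for n k g
  proof -
    let ?d = "\<lambda>x. ?b k x + (-1) * ?b n x"
    have lipd: "is_lipschitz_on X ?d" by (intro is_lipschitz_on_add is_lipschitz_on_cmult lip)
    have Td: "T ?d = T (?b k) - T (?b n)"
      by (subst add) (simp_all only: lip is_lipschitz_on_cmult cmult scaleR_minus1_left diff_conv_add_uminus)
    have "(norm (blinfun_apply (T ?d) g))\<^sup>2 = rinner (blinfun_apply (T (\<lambda>x. (?d x)\<^sup>2)) g) g"
      by (rule norm_sq[OF lipd])
    also have "\<dots> \<le> rinner (blinfun_apply (T ?d) g) g"
    proof (rule form.mono)
      fix x
      have "0 \<le> ?d x" using bump_mono[OF nk, of X U x] by simp
      moreover have "?d x \<le> 1" using bump_nonneg[of X U n x] bump_le_1[of X U k x] by simp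
      ultimately show "(?d x)\<^sup>2 \<le> ?d x"
        unfolding power2_eq_square by (intro mult_left_le_one_le)
    qed (intro is_lipschitz_on_power2 lipd)+
    finally show ?thesis unfolding Td blinfun.diff_left rinner_diff_left .
  qed
  have "\<exists>P\<in>orthogonal_projections. \<forall>g. (norm (blinfun_apply P g))\<^sup>2 = measure (scalar_measure g) U"
  proof (rule projection_strong_limit[of "\<lambda>k. T (?b k)" "\<lambda>g. measure (scalar_measure g) U"])
    show "T (?b n) \<in> hermitian_operators" for n by (rule hermitian[OF lip])
    show "norm (blinfun_apply (T (?b n)) g) \<le> norm g" for n g
    proof -
      have "(norm (blinfun_apply (T (?b n)) g))\<^sup>2 = rinner (blinfun_apply (T (\<lambda>x. (?b n x)\<^sup>2)) g) g"
        by (rule norm_sq[OF lip])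
      also have "\<dots> \<le> rinner (blinfun_apply (T (\<lambda>_. 1)) g) g"
        by (intro form.mono is_lipschitz_on_power2 lip is_lipschitz_on_const)
          (simp add: abs_square_le_1 bound)
      finally show ?thesis by (simp add: one rinner_self power2_le_iff_abs_le)
    qed
    show "(\<lambda>n. rinner (blinfun_apply (T (?b n)) g) g) \<longlonglongrightarrow> measure (scalar_measure g) U" for g
      unfolding form_eq[OF lip]
      by (rule integral_bump_tendsto(1)[OF finite_scalar_measure sets_scalar_measure U])
    show "(\<lambda>n. (norm (blinfun_apply (T (?b n)) g))\<^sup>2) \<longlonglongrightarrow> measure (scalar_measure g) U" for g
      unfolding norm_sq[OF lip] form_eq[OF is_lipschitz_on_power2[OF lip]]
      by (rule integral_bump_tendsto(2)[OF finite_scalar_measure sets_scalar_measure U])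
  qed (rule *)
  then show ?thesis by (auto simp: represents_def)
qed

text \<open>Test the scalar measure of the vector \<open>Q h\<close>: since \<open>Q\<close> fixes
  \<open>Q h\<close>, the set \<open>B\<close> already carries the whole mass, and nothing remains
  for the disjoint set \<open>A\<close>.\<close>

lemma represents_orthogonal:
  assumes P: "represents A P" and Q: "represents B Q"
    and AB: "A \<in> sets (borel_on X)" "B \<in> sets (borel_on X)" "A \<inter> B = {}"
  shows "P o\<^sub>L Q = 0"
proof (rule blinfun_eqI)
  fix h
  let ?M = "scalar_measure (blinfun_apply Q h)"
  interpret finite_measure ?M by (rule finite_scalar_measure)
  have "blinfun_apply Q (blinfun_apply Q h) = blinfun_apply Q h"
    using Q unfolding represents_def orthogonal_projections_iff
    by (metis blinfun_apply_blinfun_compose)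
  then have "(norm (blinfun_apply P (blinfun_apply Q h)))\<^sup>2 + (norm (blinfun_apply Q h))\<^sup>2 =
      measure ?M A + measure ?M B"
    using P Q unfolding represents_def by metis
  also have "\<dots> = measure ?M (A \<union> B)"
    using AB by (simp add: finite_measure_Union sets_scalar_measure)
  also have "\<dots> \<le> (norm (blinfun_apply Q h))\<^sup>2" by (rule measure_scalar_measure_le)
  finally show "blinfun_apply (P o\<^sub>L Q) h = blinfun_apply 0 h" by simp
qed

lemma represents_Compl:
  assumes P: "represents A P" and A: "A \<in> sets (borel_on X)"
  shows "represents (X - A) (id_blinfun - P)"
  unfolding represents_def
proof (intro conjI allI)
  show "id_blinfun - P \<in> orthogonal_projections"
    using P by (auto simp: represents_def intro: projection_diff_id)
  fix g
  have proj: "P \<in> orthogonal_projections" using P by (simp add: represents_def)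
  have "(norm (blinfun_apply (id_blinfun - P) g))\<^sup>2 = (norm g)\<^sup>2 - (norm (blinfun_apply P g))\<^sup>2"
    unfolding rinner_self[symmetric]
    using projection_rinner[OF proj, of g g]
    by (simp add: blinfun.diff_left rinner_diff_left rinner_diff_right
        rinner_commute[of g "blinfun_apply P g"])
  also have "\<dots> = measure (scalar_measure g) (X - A)"
    using P A finite_measure.finite_measure_compl[OF finite_scalar_measure, of A g]
    by (simp add: represents_def sets_scalar_measure space_scalar_measure measure_scalar_measure_space)
  finally show "(norm (blinfun_apply (id_blinfun - P) g))\<^sup>2 = measure (scalar_measure g) (X - A)" .
qed

text \<open>The projections \<open>P i\<close> are mutually orthogonal, so by Pythagoras the squared
  norm of a partial sum at \<open>g\<close> equals its quadratic form. The hypotheses of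
  \<open>projection_strong_limit\<close> then hold with equality in the difference estimate and with
  a common limit.\<close>

lemma represents_UN:
  fixes A :: "nat \<Rightarrow> 'x set"
  assumes A: "range A \<subseteq> sets (borel_on X)" "disjoint_family A" and P: "\<And>i. represents (A i) (P i)"
  shows "\<exists>Q. represents (\<Union>i. A i) Q"
proof -
  have A': "A i \<in> sets (borel_on X)" for i using A(1) by blast
  have proj: "P i \<in> orthogonal_projections" for i using P by (simp add: represents_def)
  have orth: "P i o\<^sub>L P j = 0" if "i \<noteq> j" for i j
    using A(2) that by (intro represents_orthogonal[OF P P] A') (auto simp: disjoint_family_on_def)
  have norm_sum: "(norm (\<Sum>i\<in>I. blinfun_apply (P i) g))\<^sup>2 = (\<Sum>i\<in>I. (norm (blinfun_apply (P i) g))\<^sup>2)"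
    if "finite I" for I g
    using that proj orth by (intro projection_orthogonal_sum) auto
  have herm: "(\<Sum>i\<in>I. P i) \<in> hermitian_operators" for I
    using proj by (induction I rule: infinite_finite_induct)
      (simp_all add: hermitian_0 hermitian_add orthogonal_projections_iff)
  have apply_sum: "blinfun_apply (\<Sum>i\<in>I. P i) g = (\<Sum>i\<in>I. blinfun_apply (P i) g)" for I g
    by (rule blinfun.sum_left)
  have form_sum: "rinner (\<Sum>i\<in>I. blinfun_apply (P i) g) g = (\<Sum>i\<in>I. (norm (blinfun_apply (P i) g))\<^sup>2)" for I g
    by (simp add: bounded_bilinear.sum_left[OF bounded_bilinear_rinner] projection_norm_sq[OF proj])
  have lim: "(\<lambda>n. \<Sum>i<n. (norm (blinfun_apply (P i) g))\<^sup>2) \<longlonglongrightarrow> measure (scalar_measure g) (\<Union>i. A i)" for g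
    using finite_measure.finite_measure_UNION[OF finite_scalar_measure, of A g] A P
    by (simp add: sums_def represents_def sets_scalar_measure)
  have "\<exists>Q\<in>orthogonal_projections. \<forall>g.
      (norm (blinfun_apply Q g))\<^sup>2 = measure (scalar_measure g) (\<Union>i. A i)"
  proof (rule projection_strong_limit[of "\<lambda>n. \<Sum>i<n. P i" "\<lambda>g. measure (scalar_measure g) (\<Union>i. A i)"])
    show "(\<Sum>i<n. P i) \<in> hermitian_operators" for n by (rule herm)
    show "norm (blinfun_apply (\<Sum>i<n. P i) g) \<le> norm g" for n g
    proof -
      have "(norm (blinfun_apply (\<Sum>i<n. P i) g))\<^sup>2 \<le> measure (scalar_measure g) (\<Union>i. A i)"
        unfolding apply_sum norm_sum[OF finite_lessThan]
        by (intro incseq_le[OF _ lim]) (auto simp: incseq_def intro!: sum_mono2)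
      also have "\<dots> \<le> (norm g)\<^sup>2" by (rule measure_scalar_measure_le)
      finally show ?thesis by (simp add: power2_le_iff_abs_le)
    qed
    show "(norm (blinfun_apply (\<Sum>i<k. P i) g - blinfun_apply (\<Sum>i<n. P i) g))\<^sup>2 \<le>
        rinner (blinfun_apply (\<Sum>i<k. P i) g) g - rinner (blinfun_apply (\<Sum>i<n. P i) g) g"
      if "n \<le> k" for n k g
    proof -
      have *: "(\<Sum>i<k. c i) - (\<Sum>i<n. c i) = (\<Sum>i\<in>{n..<k}. c i)" for c :: "nat \<Rightarrow> 'c::ab_group_add"
        using sum_diff_nat_ivl[of 0 n k c] that by (simp add: atLeast0LessThan)
      show ?thesis
        unfolding apply_sum form_sum * norm_sum[OF finite_atLeastLessThan] ..
    qed
    show "(\<lambda>n. rinner (blinfun_apply (\<Sum>i<n. P i) g) g) \<longlonglongrightarrow> measure (scalar_measure g) (\<Union>i. A i)" for g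
      unfolding apply_sum form_sum by (rule lim)
    show "(\<lambda>n. (norm (blinfun_apply (\<Sum>i<n. P i) g))\<^sup>2) \<longlonglongrightarrow> measure (scalar_measure g) (\<Union>i. A i)" for g
      unfolding apply_sum norm_sum[OF finite_lessThan] by (rule lim)
  qed
  then show ?thesis by (auto simp: represents_def)
qed

lemma represents_exists:
  assumes "A \<in> sets (borel_on X)"
  shows "\<exists>P. represents A P"
proof -
  have "{U. openin (top_of_set X) U} \<subseteq> Pow X" by (auto dest: openin_imp_subset)
  moreover have "A \<in> sigma_sets X {U. openin (top_of_set X) U}"
    using assms by (simp add: sets_borel_on[OF compact_imp_closed[OF compact]])
  ultimately show ?thesis
  proof (induction rule: sigma_sets_induct_disjoint[OF Int_stable_openin, consumes 2, case_names basic empty compl union])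
    case (basic A)
    then show ?case using represents_openin by simp
  next
    case empty
    then show ?case using represents_openin[of "{}"] by simp
  next
    case (compl A)
    then show ?case
      using represents_Compl by (auto simp: sets_borel_on[OF compact_imp_closed[OF compact]])
  next
    case (union A)
    then obtain P where "\<And>i. represents (A i) (P i)" by metis
    then show ?case
      using union by (intro represents_UN) (auto simp: sets_borel_on[OF compact_imp_closed[OF compact]])
  qed
qed

section \<open>The projections form a projection-valued measure\<close>

text \<open>The choice is harmless: the quadratic form of \<open>P\<close> is prescribed, so
  \<open>P\<close> is unique. Restricting to Borel sets gives the extensionality built into
  \<open>pvms\<close>.\<close>

definition spectral_measure :: "'x set \<Rightarrow> 'h \<Rightarrow>\<^sub>L 'h"
  where "spectral_measure = restrict (\<lambda>A. SOME P. represents A P) (sets (borel_on X))"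

lemma represents_spectral_measure:
  "A \<in> sets (borel_on X) \<Longrightarrow> represents A (spectral_measure A)"
  unfolding spectral_measure_def using someI_ex[OF represents_exists] by simp

lemma spectral_measure_projection:
  "A \<in> sets (borel_on X) \<Longrightarrow> spectral_measure A \<in> orthogonal_projections"
  using represents_spectral_measure by (simp add: represents_def)

lemma norm_spectral_measure:
  "A \<in> sets (borel_on X) \<Longrightarrow>
    (norm (blinfun_apply (spectral_measure A) g))\<^sup>2 = measure (scalar_measure g) A"
  using represents_spectral_measure by (simp add: represents_def)

lemma rinner_spectral_measure:
  "A \<in> sets (borel_on X) \<Longrightarrow>
    rinner (blinfun_apply (spectral_measure A) g) g = measure (scalar_measure g) A"
  using projection_norm_sq[OF spectral_measure_projection] norm_spectral_measure by simp

lemma spectral_measure_eqI: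
  assumes "A \<in> sets (borel_on X)" "P \<in> hermitian_operators"
    and "\<And>g. rinner (blinfun_apply P g) g = measure (scalar_measure g) A"
  shows "spectral_measure A = P"
  using assms spectral_measure_projection[OF assms(1)]
  by (intro hermitian_eqI) (simp_all add: rinner_spectral_measure orthogonal_projections_iff)

lemma spectral_measure_Un:
  assumes AB: "A \<in> sets (borel_on X)" "B \<in> sets (borel_on X)" "A \<inter> B = {}"
  shows "spectral_measure (A \<union> B) = spectral_measure A + spectral_measure B"
proof (rule spectral_measure_eqI)
  show "A \<union> B \<in> sets (borel_on X)" using AB by simp
  show "spectral_measure A + spectral_measure B \<in> hermitian_operators"
    using AB(1,2)[THEN spectral_measure_projection] by (intro hermitian_add) (auto simp: orthogonal_projections_iff)
  show "rinner (blinfun_apply (spectral_measure A + spectral_measure B) g) g =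
      measure (scalar_measure g) (A \<union> B)" for g
    using AB finite_measure.finite_measure_Union[OF finite_scalar_measure, of A g B]
    by (simp add: blinfun.add_left rinner_add_left rinner_spectral_measure sets_scalar_measure)
qed

text \<open>Follows from additivity and orthogonality alone: split \<open>A\<close> and
  \<open>B\<close> along \<open>A \<inter> B\<close>; every product of projections of disjoint
  pieces vanishes, leaving the square of the projection of \<open>A \<inter> B\<close>.\<close>

lemma spectral_measure_Int:
  assumes A: "A \<in> sets (borel_on X)" and B: "B \<in> sets (borel_on X)"
  shows "spectral_measure (A \<inter> B) = spectral_measure A o\<^sub>L spectral_measure B"
proof -
  note orth = represents_orthogonal[OF represents_spectral_measure represents_spectral_measure]
  have AB: "A \<inter> B \<in> sets (borel_on X)" "A - B \<in> sets (borel_on X)" "B - A \<in> sets (borel_on X)"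
    using A B by auto
  have dA: "spectral_measure A = spectral_measure (A \<inter> B) + spectral_measure (A - B)"
  proof -
    have "A \<inter> B \<union> (A - B) = A" "A \<inter> B \<inter> (A - B) = {}" by auto
    then show ?thesis using spectral_measure_Un[OF AB(1,2)] by simp
  qed
  have dB: "spectral_measure B = spectral_measure (A \<inter> B) + spectral_measure (B - A)"
  proof -
    have "A \<inter> B \<union> (B - A) = B" "A \<inter> B \<inter> (B - A) = {}" by auto
    then show ?thesis using spectral_measure_Un[OF AB(1,3)] by simp
  qed
  have "spectral_measure A o\<^sub>L spectral_measure B =
      (spectral_measure (A \<inter> B) o\<^sub>L spectral_measure (A \<inter> B)) +
      (spectral_measure (A \<inter> B) o\<^sub>L spectral_measure (B - A)) +
      (spectral_measure (A - B) o\<^sub>L spectral_measure B)"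
  proof (rule blinfun_eqI)
    fix g
    have "blinfun_apply (spectral_measure A) (blinfun_apply (spectral_measure B) g) =
        blinfun_apply (spectral_measure (A \<inter> B)) (blinfun_apply (spectral_measure B) g) +
        blinfun_apply (spectral_measure (A - B)) (blinfun_apply (spectral_measure B) g)"
      by (subst dA) (rule blinfun.add_left)
    also have "blinfun_apply (spectral_measure (A \<inter> B)) (blinfun_apply (spectral_measure B) g) =
        blinfun_apply (spectral_measure (A \<inter> B)) (blinfun_apply (spectral_measure (A \<inter> B)) g) +
        blinfun_apply (spectral_measure (A \<inter> B)) (blinfun_apply (spectral_measure (B - A)) g)"
      by (subst dB) (simp add: blinfun.add_left blinfun.add_right)
    finally show "blinfun_apply (spectral_measure A o\<^sub>L spectral_measure B) g =
        blinfun_apply ((spectral_measure (A \<inter> B) o\<^sub>L spectral_measure (A \<inter> B)) +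
          (spectral_measure (A \<inter> B) o\<^sub>L spectral_measure (B - A)) +
          (spectral_measure (A - B) o\<^sub>L spectral_measure B)) g"
      by (simp add: blinfun.add_left)
  qed
  also have "spectral_measure (A - B) o\<^sub>L spectral_measure B = 0"
    using AB B by (intro orth) auto
  also have "spectral_measure (A \<inter> B) o\<^sub>L spectral_measure (B - A) = 0"
    using AB by (intro orth) auto
  also have "spectral_measure (A \<inter> B) o\<^sub>L spectral_measure (A \<inter> B) = spectral_measure (A \<inter> B)"
    using spectral_measure_projection[OF AB(1)] by (simp add: orthogonal_projections_iff)
  finally show ?thesis by simp
qed

lemma spectral_measure_empty: "spectral_measure {} = 0"
  by (rule spectral_measure_eqI) (simp_all add: hermitian_0 rinner_zero_left)

text \<open>The squared distance to the \<open>n\<close>-th partial sum is the scalar measure of the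
  part of the union not yet exhausted, which tends to 0.\<close>

lemma spectral_measure_sums:
  assumes A: "range A \<subseteq> sets (borel_on X)" "disjoint_family A"
  shows "(\<lambda>n. blinfun_apply (spectral_measure (A n)) g) sums blinfun_apply (spectral_measure (\<Union>n. A n)) g"
proof -
  interpret finite_measure "scalar_measure g" by (rule finite_scalar_measure)
  have A': "A n \<in> sets (borel_on X)" for n using A(1) by blast
  have UN: "(\<Union>n. A n) \<in> sets (borel_on X)" "(\<Union>k<n. A k) \<in> sets (borel_on X)" for n
    using A' by auto
  have fin: "spectral_measure (\<Union>k<n. A k) = (\<Sum>k<n. spectral_measure (A k))" for n
  proof (induction n)
    case (Suc n)
    have "(\<Union>k<n. A k) \<inter> A n = {}"
    proof -
      have "A k \<inter> A n = {}" if "k < n" for k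
        using disjoint_family_onD[OF A(2), of k n] that by simp
      then show ?thesis by blast
    qed
    then have "spectral_measure ((\<Union>k<n. A k) \<union> A n) = spectral_measure (\<Union>k<n. A k) + spectral_measure (A n)"
      by (intro spectral_measure_Un UN A')
    then show ?case by (simp add: Suc lessThan_Suc Un_commute add.commute)
  qed (simp add: spectral_measure_empty)
  have *: "(norm (blinfun_apply (spectral_measure (\<Union>n. A n)) g -
        (\<Sum>k<n. blinfun_apply (spectral_measure (A k)) g)))\<^sup>2 =
      measure (scalar_measure g) (\<Union>n. A n) - (\<Sum>k<n. measure (scalar_measure g) (A k))" for n
  proof -
    let ?U = "\<Union>n. A n" and ?V = "\<Union>k<n. A k"
    have "spectral_measure (?V \<union> (?U - ?V)) = spectral_measure ?V + spectral_measure (?U - ?V)"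
      by (intro spectral_measure_Un UN sets.Diff) auto
    moreover have "?V \<union> (?U - ?V) = ?U" by auto
    ultimately have "spectral_measure (?U - ?V) = spectral_measure ?U - (\<Sum>k<n. spectral_measure (A k))"
      by (simp add: fin)
    then have "(norm (blinfun_apply (spectral_measure ?U) g -
        (\<Sum>k<n. blinfun_apply (spectral_measure (A k)) g)))\<^sup>2 = measure (scalar_measure g) (?U - ?V)"
      using norm_spectral_measure[OF sets.Diff[OF UN(1) UN(2)[of n]], of g]
      by (simp add: blinfun.diff_left blinfun.sum_left)
    also have "\<dots> = measure (scalar_measure g) ?U - measure (scalar_measure g) ?V"
      using UN by (intro finite_measure_Diff) (auto simp: sets_scalar_measure)
    also have "measure (scalar_measure g) ?V = (\<Sum>k<n. measure (scalar_measure g) (A k))"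
      using A A' by (intro finite_measure_finite_Union)
        (auto simp: sets_scalar_measure disjoint_family_on_def)
    finally show ?thesis .
  qed
  have "(\<lambda>n. \<Sum>k<n. measure (scalar_measure g) (A k)) \<longlonglongrightarrow> measure (scalar_measure g) (\<Union>n. A n)"
    using finite_measure_UNION[of A] A by (simp add: sums_def sets_scalar_measure)
  from tendsto_diff[OF tendsto_const[of "measure (scalar_measure g) (\<Union>n. A n)"] this]
  have "(\<lambda>n. (norm (blinfun_apply (spectral_measure (\<Union>n. A n)) g -
        (\<Sum>k<n. blinfun_apply (spectral_measure (A k)) g)))\<^sup>2) \<longlonglongrightarrow> 0"
    unfolding * by simp
  from tendsto_real_sqrt[OF this]
  have "(\<lambda>n. blinfun_apply (spectral_measure (\<Union>n. A n)) g -
        (\<Sum>k<n. blinfun_apply (spectral_measure (A k)) g)) \<longlonglongrightarrow> 0"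
    by (simp add: tendsto_norm_zero_iff)
  from tendsto_diff[OF tendsto_const[of "blinfun_apply (spectral_measure (\<Union>n. A n)) g"] this]
  show ?thesis by (simp add: sums_def)
qed

lemma spectral_measure_pvms: "spectral_measure \<in> pvms X"
proof -
  have "spectral_measure X = id_blinfun"
    by (rule spectral_measure_eqI)
      (simp_all add: space_in_sets_borel_on hermitian_id rinner_self measure_scalar_measure_space)
  then show ?thesis
    unfolding pvms_def
    using spectral_measure_projection spectral_measure_empty spectral_measure_Int spectral_measure_sums
    by (auto simp: PiE_def) (simp add: spectral_measure_def)
qed

theorem real_integral_spectral_measure:
  assumes f: "is_lipschitz_on X f"
  shows "real_integral X spectral_measure f = T f"
proof (rule real_integral_eqI[OF compact spectral_measure_pvms f hermitian[OF f]])
  fix g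
  have "pvm_measure X spectral_measure g = scalar_measure g"
  proof (rule measure_eqI)
    fix A assume "A \<in> sets (pvm_measure X spectral_measure g)"
    then show "emeasure (pvm_measure X spectral_measure g) A = emeasure (scalar_measure g) A"
      by (simp add: sets_pvm_measure emeasure_pvm_measure spectral_measure_pvms
          norm_spectral_measure finite_measure.emeasure_eq_measure finite_scalar_measure)
  qed (simp add: sets_pvm_measure sets_scalar_measure)
  then show "rinner (blinfun_apply (T f) g) g = (\<integral>x. f x \<partial>pvm_measure X spectral_measure g)"
    by (simp add: form_eq[OF f])
qed

end

section \<open>Limits of Cauchy sequences\<close>

text \<open>Every axiom is an equation or inequality valid for each \<open>E n\<close> and preserved
  by limits. For \<open>norm_sq\<close> the integrals of the square of \<open>f\<close> must
  converge too, which holds because that square is again Lipschitz.\<close>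

lemma lipschitz_calculus_limit:
  fixes E :: "nat \<Rightarrow> 'x::metric_space set \<Rightarrow> 'h::complex_hilbert_space \<Rightarrow>\<^sub>L 'h"
  assumes X: "compact X" and E: "\<And>n. E n \<in> pvms X"
    and lim: "\<And>f. is_lipschitz_on X f \<Longrightarrow> (\<lambda>n. real_integral X (E n) f) \<longlonglongrightarrow> T f"
  shows "lipschitz_calculus X T"
proof
  have lim': "(\<lambda>n. blinfun_apply (real_integral X (E n) f) g) \<longlonglongrightarrow> blinfun_apply (T f) g"
    if "is_lipschitz_on X f" for f g
    by (intro bounded_linear.tendsto[OF blinfun.bounded_linear_left] lim that)
  show "compact X" by fact
  fix f h :: "'x \<Rightarrow> real" and c :: real and g :: 'h
  assume f: "is_lipschitz_on X f"
  show "T f \<in> hermitian_operators"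
    by (rule hermitian_limit[OF real_integral_hermitian[OF X E f] lim'[OF f]])
  show "T (\<lambda>x. c * f x) = c *\<^sub>R T f"
    using lim[OF is_lipschitz_on_cmult[OF f]] tendsto_scaleR[OF tendsto_const lim[OF f]]
    unfolding real_integral_cmult[OF X E f] by (rule LIMSEQ_unique)
  show "T (\<lambda>x. f x + h x) = T f + T h" if h: "is_lipschitz_on X h"
    using lim[OF is_lipschitz_on_add[OF f h]] tendsto_add[OF lim[OF f] lim[OF h]]
    unfolding real_integral_add[OF X E f h] by (rule LIMSEQ_unique)
  show "0 \<le> rinner (blinfun_apply (T f) g) g" if nn: "\<And>x. x \<in> X \<Longrightarrow> 0 \<le> f x"
  proof (rule LIMSEQ_le_const[OF tendsto_rinner[OF lim'[OF f] tendsto_const]])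
    show "\<exists>N. \<forall>n\<ge>N. 0 \<le> rinner (blinfun_apply (real_integral X (E n) f) g) g"
      unfolding rinner_real_integral[OF X E f]
      using nn by (auto intro!: integral_nonneg_AE AE_I2 simp: space_pvm_measure)
  qed
  have f2: "is_lipschitz_on X (\<lambda>x. (f x)\<^sup>2)"
    using is_lipschitz_on_mult[OF X f f] by (simp add: power2_eq_square)
  have "(norm (blinfun_apply (real_integral X (E n) f) g))\<^sup>2 =
      rinner (blinfun_apply (real_integral X (E n) (\<lambda>x. (f x)\<^sup>2)) g) g" for n
    unfolding norm_sq_real_integral[OF X E f] rinner_real_integral[OF X E f2] ..
  then show "(norm (blinfun_apply (T f) g))\<^sup>2 = rinner (blinfun_apply (T (\<lambda>x. (f x)\<^sup>2)) g) g"
    using tendsto_power[OF tendsto_norm[OF lim'[OF f, of g]], of 2]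
      tendsto_rinner[OF lim'[OF f2, of g] tendsto_const[of g]]
    by (auto intro: LIMSEQ_unique)
next
  show "T (\<lambda>_. 1) = id_blinfun"
    using lim[OF is_lipschitz_on_const[of X 1]] unfolding real_integral_const[OF X E]
    by (auto intro: LIMSEQ_unique)
qed

theorem theorem2p11:
  fixes X :: "'x::metric_space set"
  assumes "compact X"
  shows "Metric_space (pvms X :: ('x set \<Rightarrow> 'h::complex_hilbert_space \<Rightarrow>\<^sub>L 'h) set) (pvm_dist X) \<and>
    Metric_space.mcomplete (pvms X :: ('x set \<Rightarrow> 'h \<Rightarrow>\<^sub>L 'h) set) (pvm_dist X)"
proof
  show ms: "Metric_space (pvms X :: ('x set \<Rightarrow> 'h \<Rightarrow>\<^sub>L 'h) set) (pvm_dist X)"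
    by (rule Metric_space_pvms[OF assms])
  interpret Metric_space "pvms X :: ('x set \<Rightarrow> 'h \<Rightarrow>\<^sub>L 'h) set" "pvm_dist X" by (rule ms)
  show "mcomplete"
    unfolding mcomplete_def
  proof (intro allI impI)
    fix E :: "nat \<Rightarrow> 'x set \<Rightarrow> 'h \<Rightarrow>\<^sub>L 'h" assume "MCauchy E"
    then have E: "\<And>n. E n \<in> pvms X"
      and Cauchy: "\<And>e. e > 0 \<Longrightarrow> \<exists>N. \<forall>n n'. N \<le> n \<longrightarrow> N \<le> n' \<longrightarrow> pvm_dist X (E n) (E n') < e"
      by (auto simp: MCauchy_def)
    have "\<exists>S. (\<lambda>n. real_integral X (E n) f) \<longlonglongrightarrow> S" if "is_lipschitz_on X f" for f
    proof -
      obtain C where C: "C-lipschitz_on X f" using \<open>is_lipschitz_on X f\<close> by (auto simp: is_lipschitz_on_def)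
      have C0: "C + 1 > 0" using lipschitz_on_nonneg[OF C] by simp
      have "Cauchy (\<lambda>n. real_integral X (E n) f)"
      proof (rule metric_CauchyI)
        fix e :: real assume "0 < e"
        then obtain N where N: "\<And>n n'. N \<le> n \<Longrightarrow> N \<le> n' \<Longrightarrow> pvm_dist X (E n) (E n') < e / (C + 1)"
          using Cauchy[of "e / (C + 1)"] C0 by (meson divide_pos_pos)
        have "dist (real_integral X (E m) f) (real_integral X (E n) f) < e" if "N \<le> m" "N \<le> n" for m n
        proof -
          have "dist (real_integral X (E m) f) (real_integral X (E n) f) \<le> (C + 1) * pvm_dist X (E m) (E n)"
            unfolding dist_norm by (rule norm_real_integral_diff_le[OF assms E E C])
          also have "\<dots> < e" using N[OF that] C0 by (simp add: field_simps)
          finally show ?thesis .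
        qed
        then show "\<exists>N. \<forall>m\<ge>N. \<forall>n\<ge>N. dist (real_integral X (E m) f) (real_integral X (E n) f) < e"
          by blast
      qed
      then show ?thesis by (simp add: Cauchy_convergent_iff convergent_def)
    qed
    then obtain T where T: "\<And>f. is_lipschitz_on X f \<Longrightarrow> (\<lambda>n. real_integral X (E n) f) \<longlonglongrightarrow> T f"
      by metis
    interpret lipschitz_calculus X T by (rule lipschitz_calculus_limit[OF assms E T])
    have "limitin mtopology E spectral_measure sequentially"
      unfolding limit_metric_sequentially
    proof (intro conjI allI impI spectral_measure_pvms)
      fix e :: real assume "0 < e"
      \<comment> \<open>\<open>N\<close> is fixed before \<open>f\<close>, which is the source of
        uniformity. Half of \<open>e\<close> is used because passing to the limit and to the
        supremum preserves only a weak inequality.\<close>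
      then obtain N where N: "\<And>n n'. N \<le> n \<Longrightarrow> N \<le> n' \<Longrightarrow> pvm_dist X (E n) (E n') < e / 2"
        using Cauchy[of "e / 2"] by auto
      have "pvm_dist X (E n) spectral_measure \<le> e / 2" if n: "N \<le> n" for n
      proof (rule pvm_dist_le[OF assms E spectral_measure_pvms])
        fix f :: "'x \<Rightarrow> real" assume f: "1-lipschitz_on X f"
        note lip = is_lipschitz_onI[OF f]
        \<comment> \<open>With \<open>n\<close> fixed, let the second index of the Cauchy estimate
          tend to infinity.\<close>
        have "(\<lambda>k. norm (real_integral X (E n) f - real_integral X (E k) f)) \<longlonglongrightarrow>
            norm (real_integral X (E n) f - real_integral X spectral_measure f)"
          unfolding real_integral_spectral_measure[OF lip]
          by (intro tendsto_norm tendsto_diff tendsto_const T lip)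
        moreover have "norm (real_integral X (E n) f - real_integral X (E k) f) \<le> e / 2" if "N \<le> k" for k
          using norm_real_integral_diff_le_pvm_dist[OF assms E E f, of n k] N[OF n that] by linarith
        ultimately show "norm (real_integral X (E n) f - real_integral X spectral_measure f) \<le> e / 2"
          by (blast intro: LIMSEQ_le_const2)
      qed
      then show "\<exists>N. \<forall>n\<ge>N. E n \<in> pvms X \<and> pvm_dist X (E n) spectral_measure < e"
        using E \<open>0 < e\<close> by (intro exI[of _ N]) fastforce
    qed
    then show "\<exists>F. limitin mtopology E F sequentially" by blast
  qed
qed

end
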